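(* For every $\varepsilon>0$ there exists a constant $c_{\varepsilon}>0$ such that $\vec\chi_{\ell}(KG(n,k))\geq c_{\varepsilon}\,n\ln n$ for all integers $n,k$ with $2\leq k\leq n^{\frac{1}{2}-\varepsilon}$.
   Context: The Kneser graph $KG(n,k)$ has vertex set $\binom{[n]}{k}$, two $k$-sets being adjacent iff they are disjoint. A $k$-list assignment to a digraph $D$ assigns to each vertex $v$ a set $L(v)$ of $k$ positive integers; a colouring $f$ is accepted if $f(v)\in L(v)$ for all $v$; it is proper if every colour class induces a subdigraph with no directed cycle. The list dichromatic number $\vec\chi_\ell(D)$ is the least $k$ such that every $k$-list assignment accepts a proper colouring; for an undirected graph $G$, $\vec\chi_\ell(G)$ is the maximum of $\vec\chi_\ell(D)$ over all orientations $D$ of $G$. *)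

theory Defs
  imports Complex_Main "Graph_Theory.Graph_Theory"
begin

definition proper_dicolouring :: "('a, 'b) pre_digraph \<Rightarrow> ('a \<Rightarrow> nat) \<Rightarrow> bool" where
  "proper_dicolouring D f \<longleftrightarrow>
     (\<forall>c. \<not> (\<exists>p. pre_digraph.cycle (D \<restriction> {v \<in> verts D. f v = c}) p))"

definition list_assignment :: "('a, 'b) pre_digraph \<Rightarrow> nat \<Rightarrow> ('a \<Rightarrow> nat set) \<Rightarrow> bool" where
  "list_assignment D k L \<longleftrightarrow>
     (\<forall>v \<in> verts D. L v \<subseteq> {1..} \<and> finite (L v) \<and> card (L v) = k)"

definition accepts :: "('a, 'b) pre_digraph \<Rightarrow> ('a \<Rightarrow> nat set) \<Rightarrow> ('a \<Rightarrow> nat) \<Rightarrow> bool" where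
  "accepts D L f \<longleftrightarrow> (\<forall>v \<in> verts D. f v \<in> L v)"

definition list_dicolourable :: "('a, 'b) pre_digraph \<Rightarrow> nat \<Rightarrow> bool" where
  "list_dicolourable D k \<longleftrightarrow>
     (\<forall>L. list_assignment D k L \<longrightarrow> (\<exists>f. accepts D L f \<and> proper_dicolouring D f))"

definition list_dichromatic_number :: "('a, 'b) pre_digraph \<Rightarrow> nat" where
  "list_dichromatic_number D = (LEAST k. list_dicolourable D k)"

text \<open>Undirected graphs are symmetric digraphs, as in the locale \<^locale>\<open>pair_graph\<close>;
  an orientation keeps exactly one of the two arcs representing each edge.\<close>

definition orientation :: "'a pair_pre_digraph \<Rightarrow> 'a pair_pre_digraph \<Rightarrow> bool" where
  "orientation G D \<longleftrightarrow> pverts D = pverts G \<and> parcs D \<subseteq> parcs G \<and>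
     (\<forall>(u, v) \<in> parcs G. (u, v) \<in> parcs D \<longleftrightarrow> (v, u) \<notin> parcs D)"

definition graph_list_dichromatic_number :: "'a pair_pre_digraph \<Rightarrow> nat" where
  "graph_list_dichromatic_number G =
     Max {list_dichromatic_number (with_proj D) | D. orientation G D}"

definition kneser_graph :: "nat \<Rightarrow> nat \<Rightarrow> nat set pair_pre_digraph" where
  "kneser_graph n k =
     (let V = {A. A \<subseteq> {1..n} \<and> card A = k}
      in \<lparr> pverts = V, parcs = {(A, B). A \<in> V \<and> B \<in> V \<and> A \<inter> B = {}} \<rparr>)"

text \<open>The least element and the maximum above are taken over nonempty, respectively finite
  nonempty, sets whenever the graph is finite and simple, as Kneser graphs with \<open>k > 0\<close> are.\<close>

lemma pair_graph_kneser_graph: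
  assumes "k > 0"
  shows "pair_graph (kneser_graph n k)"
proof
  let ?G = "kneser_graph n k"
  have verts: "A \<subseteq> {1..n} \<and> card A = k" if "A \<in> pverts ?G" for A
    using that by (simp add: kneser_graph_def)
  have arcs: "(A, B) \<in> parcs ?G \<longleftrightarrow> A \<in> pverts ?G \<and> B \<in> pverts ?G \<and> A \<inter> B = {}" for A B
    by (simp add: kneser_graph_def)
  show "finite (pverts ?G)"
    by (rule finite_subset[of _ "Pow {1..n}"]) (use verts in auto)
  then show "finite (parcs ?G)"
    by (intro finite_subset[of "parcs ?G" "pverts ?G \<times> pverts ?G"]) (auto simp: arcs)
  show "symmetric (with_proj ?G)"
    by (auto simp: symmetric_def arcs intro!: symI)
  fix e assume e: "e \<in> parcs ?G"
  obtain A B where [simp]: "e = (A, B)" by (cases e)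
  show "fst e \<in> pverts ?G" "snd e \<in> pverts ?G" using e by (simp_all add: arcs)
  show "fst e \<noteq> snd e" using e assms verts[of A] by (auto simp: arcs)
qed

lemma finite_orientations:
  assumes "pair_graph G"
  shows "finite {D. orientation G D}"
proof -
  interpret pair_graph G by fact
  have "{D. orientation G D} \<subseteq>
      (\<lambda>A. \<lparr> pverts = pverts G, parcs = A \<rparr>) ` Pow (parcs G)"
  proof
    fix D assume "D \<in> {D. orientation G D}"
    then show "D \<in> (\<lambda>A. \<lparr> pverts = pverts G, parcs = A \<rparr>) ` Pow (parcs G)"
      by (intro image_eqI[of _ _ "parcs D"]) (auto simp: orientation_def)
  qed
  then show ?thesis
    by (rule finite_subset) (use pair_finite_arcs in simp)
qed

lemma ex_orientation:
  assumes "pair_graph G"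
  shows "\<exists>D. orientation G D"
proof -
  interpret pair_graph G by fact
  obtain h :: "'a \<Rightarrow> nat" where h: "inj_on h (pverts G)"
    using pair_finite_verts finite_imp_inj_to_nat_seg by metis
  have sym: "(v, u) \<in> parcs G" if "(u, v) \<in> parcs G" for u v
    using pair_sym_arcs that by (auto simp: symmetric_def dest: symD)
  have "h u \<noteq> h v" if "(u, v) \<in> parcs G" for u v
    using h that in_arcsD1[OF that] in_arcsD2[OF that] pair_no_loops[OF that]
    by (auto dest: inj_onD)
  then have "orientation G \<lparr> pverts = pverts G, parcs = {(u, v) \<in> parcs G. h u < h v} \<rparr>"
    using sym by (fastforce simp: orientation_def)
  then show ?thesis ..
qed

lemma list_dicolourable_card_verts:
  assumes "loopfree_digraph D" "finite (verts D)"
  shows "list_dicolourable D (card (verts D))"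
  unfolding list_dicolourable_def
proof (intro allI impI)
  interpret loopfree_digraph D by fact
  fix L assume L: "list_assignment D (card (verts D)) L"
  have "\<exists>f. inj_on f S \<and> (\<forall>v \<in> S. f v \<in> L v)" if "S \<subseteq> verts D" for S
    using finite_subset[OF that assms(2)] that
  proof (induction S rule: finite_induct)
    case (insert x S)
    then obtain f where f: "inj_on f S" "\<forall>v \<in> S. f v \<in> L v" by auto
    have "card (f ` S) < card (L x)"
    proof -
      have "card (f ` S) \<le> card S" using insert by (simp add: card_image_le)
      also have "\<dots> < card (insert x S)" using insert by simp
      also have "\<dots> \<le> card (verts D)" by (rule card_mono[OF assms(2) insert.prems])
      finally show ?thesis using L insert by (auto simp: list_assignment_def)
    qed
    then have "\<not> L x \<subseteq> f ` S"
      using insert.hyps(1) by (meson card_mono finite_imageI leD)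
    then obtain c where "c \<in> L x" "c \<notin> f ` S" by blast
    then have "inj_on (f(x := c)) (insert x S) \<and> (\<forall>v \<in> insert x S. (f(x := c)) v \<in> L v)"
      using f insert.hyps by (auto simp: inj_on_def)
    then show ?case by blast
  qed auto
  then obtain f where f: "inj_on f (verts D)" "\<forall>v \<in> verts D. f v \<in> L v" by blast
  have "\<not> pre_digraph.cycle (D \<restriction> {v \<in> verts D. f v = c}) p" for c p
  proof
    assume cyc: "pre_digraph.cycle (D \<restriction> {v \<in> verts D. f v = c}) p"
    then obtain e where "e \<in> arcs (D \<restriction> {v \<in> verts D. f v = c})"
      by (cases p) (auto simp: pre_digraph.cycle_def pre_digraph.awalk_def)
    then have "e \<in> arcs D" "tail D e = head D e"
      using f(1) by (auto dest: inj_onD)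
    then show False using no_loops by blast
  qed
  with f show "\<exists>f. accepts D L f \<and> proper_dicolouring D f"
    by (auto simp: accepts_def proper_dicolouring_def)
qed

end

theory Submission
  imports Defs "HOL-Library.FuncSet"
begin

text \<open>
  Orient the edges at random. A union bound over orderings shows that, for some orientation, every
  acyclic vertex set \<open>U\<close> spans at most \<open>d |U|\<close> edges, where \<open>d\<close> is about \<open>k log n\<close>. This is all that
  is used about the orientation.

  Such a sparse family \<open>F\<close> lies in one of few small containers. Either fewer than \<open>4 d\<close> members of \<open>F\<close>
  avoid some set \<open>S\<close> of fewer than \<open>t\<close> points, and \<open>F\<close> is a few sets plus sets meeting \<open>S\<close>; or
  \<open>F\<close> has a subfamily \<open>G\<close> of bounded size such that every \<open>S\<close> with fewer than \<open>t\<close> points is avoided by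
  at least \<open>4 d\<close> members of \<open>G\<close>. In the second case sparsity makes all but \<open>2 |G|\<close> members of \<open>F\<close>
  intersect most of \<open>G\<close>, and at most a fraction \<open>(2 k^2 / n)^t\<close> of all \<open>k\<close>-sets does so. A container
  therefore holds a fraction \<open>O(k / n)\<close> of the vertices.

  Give each vertex a random \<open>r\<close>-subset of \<open>2 r\<close> colours. If every colour is confined to a container,
  half of the vertices have at most \<open>s = O(r k / n)\<close> admissible colours, each list misses them
  with probability at least \<open>4^-s\<close>, and for \<open>r\<close> a small multiple of \<open>n ln n\<close> a union bound over the
  choices of the \<open>2 r\<close> containers leaves lists that no proper colouring respects.
\<close>

section \<open>Orientations with sparse acyclic sets\<close>

text \<open>A finite acyclic relation is well-founded, so \<open>U\<close> has a vertex with no arc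
  into it from \<open>U\<close>. It goes first, and induction orders the rest. The list form lets a
  later union bound range over sequences of vertices.\<close>

lemma ex_topological_list:
  assumes "finite U" "acyclic (D \<inter> U \<times> U)"
  shows "\<exists>xs. distinct xs \<and> set xs = U \<and>
    (\<forall>i j. i < j \<longrightarrow> j < length xs \<longrightarrow> (xs ! j, xs ! i) \<notin> D)"
  using assms
proof (induction "card U" arbitrary: U)
  case 0
  then show ?case by (intro exI[of _ "[]"]) auto
next
  case (Suc c)
  have "wf (D \<inter> U \<times> U)"
    using Suc.prems by (intro finite_acyclic_wf) auto
  moreover obtain u where "u \<in> U" using Suc.hyps(2) by fastforce
  ultimately obtain z where z: "z \<in> U" "\<And>y. (y, z) \<in> D \<inter> U \<times> U \<Longrightarrow> y \<notin> U"
    using wfE_min by metis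
  have "acyclic (D \<inter> (U - {z}) \<times> (U - {z}))"
    by (rule acyclic_subset[OF Suc.prems(2)]) auto
  moreover have "c = card (U - {z})" using Suc.hyps(2) Suc.prems(1) z(1) by simp
  ultimately obtain xs where xs: "distinct xs" "set xs = U - {z}"
    "\<forall>i j. i < j \<longrightarrow> j < length xs \<longrightarrow> (xs ! j, xs ! i) \<notin> D"
    using Suc.hyps(1)[of "U - {z}"] Suc.prems(1) by auto
  have "((z # xs) ! j, (z # xs) ! i) \<notin> D" if ij: "i < j" "j < length (z # xs)" for i j
  proof (cases i)
    case 0
    then obtain j' where "j = Suc j'" "j' < length xs" using ij by (cases j) auto
    then show ?thesis using z(2)[of "xs ! j'"] z(1) xs(2) nth_mem[of j' xs] 0 by auto
  next
    case (Suc i')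
    then obtain j' where "j = Suc j'" using ij by (cases j) auto
    then show ?thesis using xs(3) Suc ij by auto
  qed
  then show ?case
    using xs z(1) by (intro exI[of _ "z # xs"]) auto
qed

text \<open>Only the part of \<open>X\<close> outside \<open>W\<close> is free: a uniformly random
  subset of \<open>E\<close> has a prescribed trace on \<open>W\<close> with probability at most 1
  in \<open>2 ^ card W\<close>.\<close>

lemma card_subsets_with_trace_le:
  assumes "finite E" "W \<subseteq> E"
  shows "card {X. X \<subseteq> E \<and> X \<inter> W = Y} \<le> 2 ^ (card E - card W)"
proof -
  have "inj_on (\<lambda>X. X - W) {X. X \<subseteq> E \<and> X \<inter> W = Y}"
    by (rule inj_onI) blast
  then have "card {X. X \<subseteq> E \<and> X \<inter> W = Y} \<le> card (Pow (E - W))"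
    by (rule card_inj_on_le) (use assms in auto)
  then show ?thesis
    using assms by (simp add: card_Pow card_Diff_subset finite_subset)
qed

text \<open>First moment method. If a sequence of \<open>u\<close> vertices spanning more than
  \<open>d * u\<close> edges is a topological order, the direction of all these edges is forced, so
  this happens for at most 1 in \<open>2 ^ (d * u)\<close> orientations. There are at most
  \<open>card V ^ u\<close> sequences, hence length \<open>u\<close> spoils at most a fraction
  \<open>(1 / 2) ^ u\<close>. \<open>E\<close> holds both arcs of every edge, whence the factor 2 in
  the conclusion.\<close>

lemma ex_orientation_sparse_acyclic:
  fixes E :: "('a \<times> 'a) set"
  assumes V: "finite V" and E: "E \<subseteq> V \<times> V" "sym E" "irrefl E" and d: "2 * card V \<le> 2 ^ d"
  shows "\<exists>D \<subseteq> E. (\<forall>(u, v) \<in> E. (u, v) \<in> D \<longleftrightarrow> (v, u) \<notin> D) \<and>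
    (\<forall>U \<subseteq> V. acyclic (D \<inter> U \<times> U) \<longrightarrow> card (E \<inter> U \<times> U) \<le> 2 * d * card U)"
proof -
  obtain h :: "'a \<Rightarrow> nat" where h: "inj_on h V"
    using V finite_imp_inj_to_nat_seg by metis
  have hne: "h u \<noteq> h v" if "(u, v) \<in> E" for u v
    using h that E by (auto dest: inj_onD simp: irrefl_def)
  define Ed where "Ed = {(u, v) \<in> E. h u < h v}"
  have finE: "finite E" using E V by (meson finite_SigmaI finite_subset)
  have finEd: "finite Ed" by (rule finite_subset[OF _ finE]) (auto simp: Ed_def)
  \<comment> \<open>Orientations are encoded by subsets \<open>X\<close> of \<open>Ed\<close>: edges
    in \<open>X\<close> point towards the larger value of \<open>h\<close>, the others are reversed.
    A uniform \<open>X\<close> is a uniform orientation.\<close>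
  define orient where "orient X = X \<union> (Ed - X)\<inverse>" for X
  define e where "e U = card (Ed \<inter> U \<times> U)" for U
  have e: "card (E \<inter> U \<times> U) = 2 * e U" for U
  proof -
    have "(u, v) \<in> Ed \<or> (v, u) \<in> Ed" if "(u, v) \<in> E" for u v
      using that hne[OF that] E(2) by (auto simp: Ed_def dest: symD)
    moreover have "(u, v) \<in> E \<and> (v, u) \<in> E" if "(u, v) \<in> Ed" for u v
      using that E(2) by (auto simp: Ed_def dest: symD)
    ultimately have "E \<inter> U \<times> U = (Ed \<inter> U \<times> U) \<union> (Ed \<inter> U \<times> U)\<inverse>"
      by blast
    also have "card \<dots> = card (Ed \<inter> U \<times> U) + card ((Ed \<inter> U \<times> U)\<inverse>)"
      by (rule card_Un_disjoint) (use finEd in \<open>auto simp: Ed_def\<close>)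
    finally show ?thesis by (simp add: e_def)
  qed
  define before where "before xs = {(xs ! i, xs ! j) |i j. i < j \<and> j < length xs}" for xs :: "'a list"
  define topo where "topo xs X \<longleftrightarrow> (\<forall>i j. i < j \<longrightarrow> j < length xs \<longrightarrow> (xs ! j, xs ! i) \<notin> orient X)" for xs X
  \<comment> \<open>Sequences with repetitions are not excluded; they only make the union bound
    cruder.\<close>
  define dense where "dense u = {xs. set xs \<subseteq> V \<and> length xs = u \<and> d * u < e (set xs)}" for u
  have trace: "X \<inter> (set xs \<times> set xs) = Ed \<inter> before xs"
    if "topo xs X" "X \<subseteq> Ed" for xs X
  proof (intro equalityI subrelI)
    fix u v assume "(u, v) \<in> X \<inter> (set xs \<times> set xs)"
    then obtain i j where ij: "u = xs ! i" "v = xs ! j" "i < length xs" "j < length xs" "(u, v) \<in> X"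
      by (auto simp: in_set_conv_nth)
    moreover have "u \<noteq> v" using ij(5) that by (auto simp: Ed_def)
    moreover have "\<not> j < i"
      using that(1) ij unfolding topo_def orient_def by blast
    ultimately have "i < j" by (metis linorder_neqE_nat)
    then show "(u, v) \<in> Ed \<inter> before xs" using ij that by (auto simp: before_def)
  next
    fix u v assume "(u, v) \<in> Ed \<inter> before xs"
    then obtain i j where ij: "u = xs ! i" "v = xs ! j" "i < j" "j < length xs" "(u, v) \<in> Ed"
      by (auto simp: before_def)
    then have "(v, u) \<notin> orient X" using that by (auto simp: topo_def)
    then show "(u, v) \<in> X \<inter> (set xs \<times> set xs)" using ij by (auto simp: orient_def)
  qed
  have card_topo: "real (card {X. X \<subseteq> Ed \<and> topo xs X}) \<le> 2 ^ card Ed / 2 ^ (d * u)"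
    if "xs \<in> dense u" for xs u
  proof -
    let ?W = "Ed \<inter> set xs \<times> set xs"
    have "{X. X \<subseteq> Ed \<and> topo xs X} \<subseteq> {X. X \<subseteq> Ed \<and> X \<inter> ?W = Ed \<inter> before xs}"
      using trace by blast
    then have "card {X. X \<subseteq> Ed \<and> topo xs X} \<le> card {X. X \<subseteq> Ed \<and> X \<inter> ?W = Ed \<inter> before xs}"
      by (intro card_mono) (use finEd in auto)
    also have "\<dots> \<le> 2 ^ (card Ed - card ?W)"
      by (rule card_subsets_with_trace_le) (use finEd in auto)
    also have "\<dots> \<le> 2 ^ (card Ed - d * u)"
      using that by (intro power_increasing) (auto simp: dense_def e_def)
    finally have "real (card {X. X \<subseteq> Ed \<and> topo xs X}) \<le> 2 ^ (card Ed - d * u)"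
      by (simp flip: of_nat_le_iff)
    moreover have "d * u \<le> card Ed"
      using that card_mono[OF finEd, of ?W] by (auto simp: dense_def e_def)
    ultimately show ?thesis by (simp add: power_diff)
  qed
  have fin_dense: "finite (dense u)" for u
    by (rule finite_subset[OF _ finite_lists_length_eq[OF V, of u]]) (auto simp: dense_def)
  have card_dense: "card (dense u) \<le> card V ^ u" for u
  proof -
    have "card (dense u) \<le> card {xs. set xs \<subseteq> V \<and> length xs = u}"
      by (intro card_mono finite_lists_length_eq V) (auto simp: dense_def)
    then show ?thesis by (simp add: card_lists_length_eq V)
  qed
  \<comment> \<open>Starting at \<open>u = 1\<close> keeps the geometric sum at
    \<open>1 - (1 / 2) ^ card V\<close>, strictly below 1.\<close>
  define bad where "bad = (\<Union>u \<in> {1..card V}. \<Union>xs \<in> dense u. {X. X \<subseteq> Ed \<and> topo xs X})"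
  have "real (card bad) \<le> (\<Sum>u = 1..card V. real (card (\<Union>xs \<in> dense u. {X. X \<subseteq> Ed \<and> topo xs X})))"
    unfolding bad_def using card_UN_le[of "{1..card V}" "\<lambda>u. \<Union>xs \<in> dense u. {X. X \<subseteq> Ed \<and> topo xs X}"]
    by (simp flip: of_nat_sum)
  also have "\<dots> \<le> (\<Sum>u = 1..card V. 2 ^ card Ed * (1 / 2) ^ u)"
  proof (rule sum_mono)
    fix u assume "u \<in> {1..card V}"
    have "real (card (\<Union>xs \<in> dense u. {X. X \<subseteq> Ed \<and> topo xs X}))
        \<le> real (\<Sum>xs \<in> dense u. card {X. X \<subseteq> Ed \<and> topo xs X})"
      using card_UN_le[OF fin_dense] of_nat_le_iff by blast
    also have "\<dots> \<le> (\<Sum>xs \<in> dense u. 2 ^ card Ed / 2 ^ (d * u))"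
      unfolding of_nat_sum by (intro sum_mono card_topo)
    also have "\<dots> = real (card (dense u)) * (2 ^ card Ed / 2 ^ (d * u))" by simp
    also have "\<dots> \<le> real (card V ^ u) * (2 ^ card Ed / 2 ^ (d * u))"
      by (intro mult_right_mono) (use card_dense[of u] in \<open>simp_all only: of_nat_le_iff, simp\<close>)
    also have "\<dots> = 2 ^ card Ed * (real (card V) / 2 ^ d) ^ u"
      by (simp add: power_mult power_divide)
    also have "\<dots> \<le> 2 ^ card Ed * (1 / 2) ^ u"
    proof (intro mult_left_mono power_mono)
      have "real (2 * card V) \<le> real (2 ^ d)" using d of_nat_le_iff by blast
      then show "real (card V) / 2 ^ d \<le> 1 / 2" by (simp add: field_simps)
    qed auto
    finally show "real (card (\<Union>xs \<in> dense u. {X. X \<subseteq> Ed \<and> topo xs X})) \<le> 2 ^ card Ed * (1 / 2) ^ u" .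
  qed
  also have "\<dots> = 2 ^ card Ed * (1 - (1 / 2) ^ card V)"
  proof -
    have "(\<Sum>u = 1..N. (1 / 2 :: real) ^ u) = 1 - (1 / 2) ^ N" for N
      by (induction N) auto
    then show ?thesis by (simp flip: sum_distrib_left)
  qed
  also have "\<dots> < real (card (Pow Ed))"
    using finEd by (simp add: card_Pow)
  finally have "card bad < card (Pow Ed)" by simp
  then have "\<not> Pow Ed \<subseteq> bad"
  proof (intro notI)
    assume "card bad < card (Pow Ed)" "Pow Ed \<subseteq> bad"
    moreover have "finite bad"
      by (rule finite_subset[of _ "Pow Ed"]) (use finEd in \<open>auto simp: bad_def\<close>)
    ultimately show False using card_mono leD by blast
  qed
  then obtain X where X: "X \<subseteq> Ed" "X \<notin> bad" by blast
  show ?thesis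
  proof (intro exI[of _ "orient X"] conjI)
    show "orient X \<subseteq> E" using X(1) E(2) by (auto simp: orient_def Ed_def sym_def)
    have "(u, v) \<in> orient X \<longleftrightarrow> (v, u) \<notin> orient X" if "(u, v) \<in> E" for u v
    proof (cases "h u < h v")
      case True
      then have "(u, v) \<in> Ed" "(v, u) \<notin> Ed" using that by (auto simp: Ed_def)
      then show ?thesis using X(1) by (auto simp: orient_def)
    next
      case False
      then have "(u, v) \<notin> Ed" "(v, u) \<in> Ed"
        using that hne[OF that] E(2) by (auto simp: Ed_def dest: symD)
      then show ?thesis using X(1) by (auto simp: orient_def)
    qed
    then show "\<forall>(u, v) \<in> E. (u, v) \<in> orient X \<longleftrightarrow> (v, u) \<notin> orient X" by blast
    show "\<forall>U \<subseteq> V. acyclic (orient X \<inter> U \<times> U) \<longrightarrow> card (E \<inter> U \<times> U) \<le> 2 * d * card U"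
    proof (intro allI impI, rule ccontr)
      fix U assume U: "U \<subseteq> V" "acyclic (orient X \<inter> U \<times> U)" "\<not> card (E \<inter> U \<times> U) \<le> 2 * d * card U"
      have "finite U" using U V finite_subset by blast
      then obtain xs where xs: "distinct xs" "set xs = U" "topo xs X"
        using ex_topological_list[OF _ U(2)] unfolding topo_def by blast
      have len: "length xs = card U" using xs distinct_card by metis
      have "U \<noteq> {}" using U(3) by auto
      then have "card U \<in> {1..card V}"
        using U(1) V \<open>finite U\<close> by (simp add: card_mono Suc_le_eq card_gt_0_iff)
      moreover have "xs \<in> dense (card U)"
        using xs U len e[of U] by (auto simp: dense_def)
      ultimately show False using X xs(3) unfolding bad_def by blast
    qed
  qed
qed

section \<open>Containers\<close>

text \<open>A branching construction. Take \<open>m\<close> members \<open>G0\<close> and, for each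
  of the at most \<open>m * k\<close> points \<open>x\<close> they cover, a family obtained
  inductively from the members avoiding \<open>x\<close>. A set \<open>S\<close> that misses these
  points is avoided by all of \<open>G0\<close>; otherwise it contains such an \<open>x\<close>, and
  the family for \<open>x\<close> handles \<open>S - {x}\<close>. The factor 2 in the size bound
  absorbs \<open>G0\<close>.\<close>

lemma robust_subfamily:
  assumes "0 < k" "0 < m" "\<And>A. A \<in> F \<Longrightarrow> finite A \<and> card A \<le> k"
    and "\<And>S. finite S \<Longrightarrow> card S < t \<Longrightarrow> m \<le> card {M \<in> F. M \<inter> S = {}}"
  shows "\<exists>G \<subseteq> F. finite G \<and> card G \<le> (2 * k * m) ^ t \<and>
    (\<forall>S. finite S \<longrightarrow> card S < t \<longrightarrow> m \<le> card {M \<in> G. M \<inter> S = {}})"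
  using assms(3,4)
proof (induction t arbitrary: F)
  case 0
  show ?case by (intro exI[of _ "{}"]) auto
next
  case (Suc t)
  have "m \<le> card {M \<in> F. M \<inter> {} = {}}" using Suc.prems(2)[of "{}"] by simp
  then obtain G0 where G0: "G0 \<subseteq> F" "card G0 = m" "finite G0"
    using obtain_subset_with_card_n[of m F] by auto
  have "\<forall>x. \<exists>H \<subseteq> {M \<in> F. x \<notin> M}. finite H \<and> card H \<le> (2 * k * m) ^ t \<and>
      (\<forall>S. finite S \<longrightarrow> card S < t \<longrightarrow> m \<le> card {M \<in> H. M \<inter> S = {}})"
  proof (rule allI, rule Suc.IH)
    fix x and S :: "'a set" assume S: "finite S" "card S < t"
    have "card (insert x S) < Suc t" using S by (simp add: card_insert_if)
    then have "m \<le> card {M \<in> F. M \<inter> insert x S = {}}" using Suc.prems(2) S by blast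
    also have "{M \<in> F. M \<inter> insert x S = {}} = {M \<in> {M \<in> F. x \<notin> M}. M \<inter> S = {}}" by auto
    finally show "m \<le> card {M \<in> {M \<in> F. x \<notin> M}. M \<inter> S = {}}" .
  qed (use Suc.prems(1) in blast)
  from choice[OF this] obtain H where H: "\<And>x. H x \<subseteq> {M \<in> F. x \<notin> M}" "\<And>x. finite (H x)"
    "\<And>x. card (H x) \<le> (2 * k * m) ^ t"
    "\<And>x S. finite S \<Longrightarrow> card S < t \<Longrightarrow> m \<le> card {M \<in> H x. M \<inter> S = {}}"
    by blast
  define G where "G = G0 \<union> (\<Union>x \<in> \<Union>G0. H x)"
  have finU: "finite (\<Union>G0)" using G0 Suc.prems(1) by blast
  have finG: "finite G" unfolding G_def using G0(3) H(2) finU by (intro finite_UnI finite_UN_I)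
  show ?case
  proof (intro exI[of _ G] conjI allI impI)
    show "G \<subseteq> F" using G0 H(1) by (auto simp: G_def)
    show "finite G" by (rule finG)
    have "card (\<Union>G0) \<le> (\<Sum>M \<in> G0. card M)"
      using card_Union_le_sum_card by blast
    also have "\<dots> \<le> (\<Sum>M \<in> G0. k)"
      using G0(1) Suc.prems(1) by (intro sum_mono) auto
    finally have U: "card (\<Union>G0) \<le> m * k" using G0 by simp
    have "card (\<Union>x \<in> \<Union>G0. H x) \<le> (\<Sum>x \<in> \<Union>G0. card (H x))"
      by (rule card_UN_le[OF finU])
    also have "\<dots> \<le> (\<Sum>x \<in> \<Union>G0. (2 * k * m) ^ t)"
      by (intro sum_mono H)
    also have "\<dots> \<le> (m * k) * (2 * k * m) ^ t" using U by simp
    finally have "card G \<le> m + (m * k) * (2 * k * m) ^ t"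
      using card_Un_le[of G0 "\<Union>x \<in> \<Union>G0. H x"] G0(2) unfolding G_def by linarith
    also have "m * 1 \<le> m * (k * (2 * k * m) ^ t)"
      using assms(1,2) by (intro mult_left_mono) (auto simp: Suc_le_eq)
    then have "m + (m * k) * (2 * k * m) ^ t \<le> (2 * k * m) ^ Suc t" by (simp add: algebra_simps)
    finally show "card G \<le> (2 * k * m) ^ Suc t" .
    fix S :: "'a set" assume S: "finite S" "card S < Suc t"
    show "m \<le> card {M \<in> G. M \<inter> S = {}}"
    proof (cases "\<exists>x \<in> S. x \<in> \<Union>G0")
      case False
      then have "G0 \<subseteq> {M \<in> G. M \<inter> S = {}}" by (auto simp: G_def)
      then show ?thesis using card_mono[of "{M \<in> G. M \<inter> S = {}}" G0] G0(2) finG by simp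
    next
      case True
      then obtain x where x: "x \<in> S" "x \<in> \<Union>G0" by blast
      have "card S = Suc (card (S - {x}))" using card_Suc_Diff1[OF S(1) x(1)] by simp
      then have "m \<le> card {M \<in> H x. M \<inter> (S - {x}) = {}}"
        using S by (intro H(4)) auto
      also have "\<dots> \<le> card {M \<in> G. M \<inter> S = {}}"
      proof (rule card_mono)
        show "finite {M \<in> G. M \<inter> S = {}}" using finG by simp
        show "{M \<in> H x. M \<inter> (S - {x}) = {}} \<subseteq> {M \<in> G. M \<inter> S = {}}"
          using H(1)[of x] x(2) by (auto simp: G_def)
      qed
      finally show ?thesis .
    qed
  qed
qed

section \<open>Counting \<open>k\<close>-sets that contain given points or meet most members of a
  family\<close>

text \<open>Each forced point contributes a factor \<open>(k - i) / (n - i)\<close>, which is at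
  most \<open>k / n\<close> because \<open>k \<le> n\<close>.\<close>

lemma binomial_diff_le:
  assumes "j \<le> k" "k \<le> n" "0 < n"
  shows "real ((n - j) choose (k - j)) \<le> (real k / real n) ^ j * real (n choose k)"
  using assms(1)
proof (induction j)
  case (Suc j)
  let ?c = "\<lambda>j. real ((n - j) choose (k - j))"
  have "(n - j) * ((n - j - 1) choose (k - j - 1)) = (k - j) * ((n - j) choose (k - j))"
    using Suc.prems times_binomial_minus1_eq[of "k - j" "n - j"] by simp
  then have "real (n - j) * ?c (Suc j) = real (k - j) * ?c j"
    by (metis diff_diff_left of_nat_mult plus_1_eq_Suc add.commute)
  then have "?c (Suc j) = (real (k - j) / real (n - j)) * ?c j"
    using Suc.prems assms by (simp add: field_simps)
  also have "\<dots> \<le> (real k / real n) * ?c j"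
  proof (intro mult_right_mono)
    have "real (k - j) * real n \<le> real k * real (n - j)"
    proof -
      have "real j * real k \<le> real j * real n" using assms by (intro mult_left_mono) auto
      then show ?thesis using Suc.prems assms by (simp add: of_nat_diff algebra_simps)
    qed
    then show "real (k - j) / real (n - j) \<le> real k / real n"
      using Suc.prems assms by (simp add: field_simps)
  qed auto
  also have "\<dots> \<le> (real k / real n) * ((real k / real n) ^ j * real (n choose k))"
    using Suc by (intro mult_left_mono) auto
  finally show ?case by simp
qed auto

lemma card_subsets_above_le:
  assumes "finite X" "X \<noteq> {}" "k \<le> card X" "finite S"
  shows "real (card {A. A \<subseteq> X \<and> card A = k \<and> S \<subseteq> A})
    \<le> (real k / real (card X)) ^ card S * real (card X choose k)"
proof (cases "S \<subseteq> X \<and> card S \<le> k")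
  case False
  then have "{A. A \<subseteq> X \<and> card A = k \<and> S \<subseteq> A} = {}"
    using assms(1) by (auto dest: card_mono finite_subset)
  then show ?thesis by (simp only: card.empty) simp
next
  case True
  have "inj_on (\<lambda>A. A - S) {A. A \<subseteq> X \<and> card A = k \<and> S \<subseteq> A}"
    by (rule inj_onI) blast
  moreover have "(\<lambda>A. A - S) ` {A. A \<subseteq> X \<and> card A = k \<and> S \<subseteq> A}
      \<subseteq> {B. B \<subseteq> X - S \<and> card B = k - card S}"
    using assms(4) by (auto simp: card_Diff_subset)
  moreover have "finite {B. B \<subseteq> X - S \<and> card B = k - card S}" using assms(1) by simp
  ultimately have "card {A. A \<subseteq> X \<and> card A = k \<and> S \<subseteq> A} \<le> card {B. B \<subseteq> X - S \<and> card B = k - card S}"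
    using card_inj_on_le by blast
  also have "\<dots> = (card X - card S) choose (k - card S)"
    using assms True by (simp add: n_subsets card_Diff_subset)
  finally have "real (card {A. A \<subseteq> X \<and> card A = k \<and> S \<subseteq> A}) \<le> real ((card X - card S) choose (k - card S))"
    by simp
  also have "\<dots> \<le> (real k / real (card X)) ^ card S * real (card X choose k)"
    using assms True by (intro binomial_diff_le) (auto simp: card_gt_0_iff)
  finally show ?thesis .
qed

text \<open>A set \<open>A\<close> counted here meets at least half of the members of
  \<open>G\<close> that avoid a small \<open>S\<close>, so a member met by \<open>A\<close> and a
  point of \<open>A\<close> in it can be guessed at the cost of a factor \<open>2 * k\<close>. After
  \<open>t\<close> guesses, \<open>t\<close> points of \<open>A\<close> are known, which gains
  \<open>(k / card X) ^ t\<close>.\<close>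

lemma card_mostly_intersecting_le:
  assumes X: "finite X" "X \<noteq> {}" "k \<le> card X" and "0 < m" and G: "finite G"
    "\<And>M. M \<in> G \<Longrightarrow> finite M \<and> card M \<le> k"
    and robust: "\<And>S. finite S \<Longrightarrow> card S < t \<Longrightarrow> m \<le> card {M \<in> G. M \<inter> S = {}}"
  shows "real (card {A. A \<subseteq> X \<and> card A = k \<and> 2 * card {M \<in> G. M \<inter> A = {}} \<le> m})
    \<le> (2 * real k ^ 2 / real (card X)) ^ t * real (card X choose k)"
proof -
  define a where "a S = {A. A \<subseteq> X \<and> card A = k \<and> S \<subseteq> A \<and> 2 * card {M \<in> G. M \<inter> A = {}} \<le> m}" for S
  define b where "b = (real k / real (card X)) ^ t * real (card X choose k)"
  have fin_a: "finite (a S)" for S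
    by (rule finite_subset[of _ "Pow X"]) (use X in \<open>auto simp: a_def\<close>)
  \<comment> \<open>Downward induction on \<open>card S\<close>: \<open>i\<close> is the number of
    points still to be guessed.\<close>
  have "real (card (a S)) \<le> (2 * real k) ^ i * b" if "finite S" "card S + i = t" for S i
    using that
  proof (induction i arbitrary: S)
    case 0
    have "real (card (a S)) \<le> real (card {A. A \<subseteq> X \<and> card A = k \<and> S \<subseteq> A})"
      using X by (intro of_nat_mono card_mono) (auto simp: a_def)
    also have "\<dots> \<le> b"
      using card_subsets_above_le[OF X 0(1)] 0 by (simp add: b_def)
    finally show ?case by simp
  next
    case (Suc i)
    let ?bd = "(2 * real k) ^ i * b"
    define G' where "G' = {M \<in> G. M \<inter> S = {}}"
    have G': "m \<le> card G'" "finite G'"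
      using robust Suc.prems G by (auto simp: G'_def)
    \<comment> \<open>\<open>A\<close> misses at most \<open>m / 2\<close> sets of \<open>G\<close>,
      and \<open>m \<le> card G'\<close>.\<close>
    have half: "card G' \<le> 2 * card {M \<in> G'. M \<inter> A \<noteq> {}}" if "A \<in> a S" for A
    proof -
      have "card {M \<in> G'. M \<inter> A = {}} \<le> card {M \<in> G. M \<inter> A = {}}"
        using G by (intro card_mono) (auto simp: G'_def)
      moreover have "card G' = card {M \<in> G'. M \<inter> A = {}} + card {M \<in> G'. M \<inter> A \<noteq> {}}"
        using G'(2) by (subst card_Un_disjoint[symmetric]) (auto intro!: arg_cong[where f = card])
      ultimately show ?thesis using that G'(1) by (auto simp: a_def)
    qed
    have star: "real (card {A \<in> a S. M \<inter> A \<noteq> {}}) \<le> real k * ?bd" if M: "M \<in> G'" for M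
    proof -
      have "card {A \<in> a S. M \<inter> A \<noteq> {}} \<le> card (\<Union>x \<in> M. a (insert x S))"
      proof (rule card_mono)
        show "finite (\<Union>x \<in> M. a (insert x S))"
          using M G fin_a by (intro finite_UN_I) (auto simp: G'_def)
      qed (auto simp: a_def)
      also have "\<dots> \<le> (\<Sum>x \<in> M. card (a (insert x S)))"
        using M G by (intro card_UN_le) (auto simp: G'_def)
      finally have "real (card {A \<in> a S. M \<inter> A \<noteq> {}}) \<le> (\<Sum>x \<in> M. real (card (a (insert x S))))"
        by (simp flip: of_nat_sum)
      also have "\<dots> \<le> (\<Sum>x \<in> M. ?bd)"
      proof (rule sum_mono)
        fix x assume "x \<in> M"
        then have "x \<notin> S" using M by (auto simp: G'_def)
        then show "real (card (a (insert x S))) \<le> ?bd" using Suc by simp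
      qed
      also have "\<dots> = real (card M) * ?bd" by simp
      also have "\<dots> \<le> real k * ?bd"
        using M G by (intro mult_right_mono) (auto simp: G'_def b_def)
      finally show ?thesis .
    qed
    \<comment> \<open>Double counting of the pairs of a set in \<open>a S\<close> and a member of
      \<open>G'\<close> that it meets.\<close>
    have "real (card G') * real (card (a S)) = (\<Sum>A \<in> a S. real (card G'))" by simp
    also have "\<dots> \<le> (\<Sum>A \<in> a S. real (2 * card {M \<in> G'. M \<inter> A \<noteq> {}}))"
      using half by (intro sum_mono of_nat_mono)
    also have "\<dots> = 2 * real (\<Sum>A \<in> a S. card {M \<in> G'. M \<inter> A \<noteq> {}})"
      by (simp add: sum_distrib_left)
    also have "(\<Sum>A \<in> a S. card {M \<in> G'. M \<inter> A \<noteq> {}}) = (\<Sum>M \<in> G'. card {A \<in> a S. M \<inter> A \<noteq> {}})"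
      by (rule sum_multicount_gen) (use fin_a G' in auto)
    also have "2 * real \<dots> \<le> 2 * (\<Sum>M \<in> G'. real k * ?bd)"
      unfolding of_nat_sum by (intro mult_left_mono sum_mono star) auto
    also have "\<dots> = real (card G') * ((2 * real k) ^ Suc i * b)" by simp
    finally show ?case using G' \<open>0 < m\<close> by (simp only: mult_le_cancel_left)
  qed
  from this[of "{}" t] have "real (card (a {})) \<le> (2 * real k) ^ t * b" by simp
  also have "\<dots> = (2 * real k * (real k / real (card X))) ^ t * real (card X choose k)"
    unfolding b_def power_mult_distrib by simp
  also have "2 * real k * (real k / real (card X)) = 2 * real k ^ 2 / real (card X)"
    by (simp add: power2_eq_square)
  finally show ?thesis by (simp add: a_def)
qed

section \<open>Containers for sparse families of \<open>k\<close>-sets\<close>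

text \<open>The arcs between \<open>Y\<close> and \<open>G\<close>, in both directions, already
  number at least \<open>2 * (2 * d + 1) * card Y\<close>, while sparsity of
  \<open>G \<union> Y\<close> allows only \<open>2 * d * (card G + card Y)\<close>.\<close>

lemma card_high_degree_le:
  assumes F: "finite F" "G \<subseteq> F" and E: "sym E" "card (E \<inter> (G \<union> Y) \<times> (G \<union> Y)) \<le> 2 * d * card (G \<union> Y)"
    and Y: "Y = {A \<in> F - G. 2 * d < card {M \<in> G. (A, M) \<in> E}}"
  shows "card Y \<le> card G"
proof -
  have fin: "finite G" "finite Y" using F finite_subset unfolding Y by auto
  define W where "W = (SIGMA A:Y. {M \<in> G. (A, M) \<in> E})"
  have finW: "finite W" using fin by (auto simp: W_def)
  have "card Y * (2 * d + 1) = (\<Sum>A \<in> Y. 2 * d + 1)" by simp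
  also have "\<dots> \<le> (\<Sum>A \<in> Y. card {M \<in> G. (A, M) \<in> E})"
    by (intro sum_mono) (auto simp: Y)
  also have "\<dots> = card W" using fin by (simp add: W_def)
  finally have W: "card Y * (2 * d + 1) \<le> card W" .
  have "2 * card W = card W + card (W\<inverse>)" by simp
  also have "\<dots> = card (W \<union> W\<inverse>)"
    by (rule card_Un_disjoint[symmetric]) (use finW in \<open>auto simp: W_def Y\<close>)
  also have "\<dots> \<le> card (E \<inter> (G \<union> Y) \<times> (G \<union> Y))"
    using fin E(1) by (intro card_mono) (auto simp: W_def sym_def)
  also have "\<dots> \<le> 2 * d * (card G + card Y)"
    using E(2) card_Un_le[of G Y] by (meson le_trans mult_le_mono2)
  finally have "2 * (card Y * (2 * d + 1)) \<le> 2 * d * (card G + card Y)" using W by linarith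
  then have "(d + 1) * card Y \<le> d * card G" by (simp add: algebra_simps)
  also have "\<dots> \<le> (d + 1) * card G" by simp
  finally show ?thesis by (simp only: mult_le_cancel1)
qed

text \<open>A set of at most \<open>j\<close> points is read off from a sequence of length exactly
  \<open>j\<close> over \<open>X\<close> and the padding symbol \<open>None\<close>.\<close>

lemma card_small_subsets_le:
  assumes "finite X"
  shows "card {S. S \<subseteq> X \<and> card S \<le> j} \<le> (card X + 1) ^ j"
proof -
  let ?Z = "insert None (Some ` X)"
  let ?L = "{xs. set xs \<subseteq> ?Z \<and> length xs = j}"
  have fin: "finite ?L" using assms by (intro finite_lists_length_eq) simp
  have "{S. S \<subseteq> X \<and> card S \<le> j} \<subseteq> (\<lambda>xs. {x. Some x \<in> set xs}) ` ?L"
  proof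
    fix S assume S: "S \<in> {S. S \<subseteq> X \<and> card S \<le> j}"
    then obtain ys where ys: "set ys = S" "distinct ys"
      using assms finite_distinct_list finite_subset by (metis mem_Collect_eq)
    have "length ys = card S" using ys distinct_card by metis
    then show "S \<in> (\<lambda>xs. {x. Some x \<in> set xs}) ` ?L"
      using S ys by (intro image_eqI[of _ _ "map Some ys @ replicate (j - card S) None"]) auto
  qed
  then have "card {S. S \<subseteq> X \<and> card S \<le> j} \<le> card ?L"
    using card_mono card_image_le fin finite_imageI le_trans by (metis (no_types, lifting))
  also have "\<dots> = card ?Z ^ j" using assms by (intro card_lists_length_eq) simp
  also have "card ?Z = card X + 1" using assms by (simp add: card_image)
  finally show "card {S. S \<subseteq> X \<and> card S \<le> j} \<le> (card X + 1) ^ j" .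
qed

lemma card_star_le:
  assumes X: "finite X" "X \<noteq> {}" "k \<le> card X" and S: "finite S" "card S \<le> t"
  shows "real (card {A. A \<subseteq> X \<and> card A = k \<and> A \<inter> S \<noteq> {}})
    \<le> real t * (real k / real (card X)) * real (card X choose k)"
proof -
  let ?V = "\<lambda>x. {A. A \<subseteq> X \<and> card A = k \<and> {x} \<subseteq> A}"
  have "card {A. A \<subseteq> X \<and> card A = k \<and> A \<inter> S \<noteq> {}} \<le> card (\<Union>x \<in> S. ?V x)"
    using X S by (intro card_mono finite_UN_I) auto
  also have "\<dots> \<le> (\<Sum>x \<in> S. card (?V x))"
    by (rule card_UN_le[OF S(1)])
  finally have "real (card {A. A \<subseteq> X \<and> card A = k \<and> A \<inter> S \<noteq> {}}) \<le> (\<Sum>x \<in> S. real (card (?V x)))"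
    by (simp flip: of_nat_sum)
  also have "\<dots> \<le> (\<Sum>x \<in> S. real k / real (card X) * real (card X choose k))"
    using card_subsets_above_le[OF X, of "{_}"] by (intro sum_mono) simp
  also have "\<dots> = real (card S) * (real k / real (card X) * real (card X choose k))" by simp
  also have "\<dots> \<le> real t * (real k / real (card X) * real (card X choose k))"
    using S by (intro mult_right_mono) auto
  finally show ?thesis by (simp add: mult.assoc)
qed

text \<open>The two summands of the count and the two entries of the maximum belong to two kinds of
  containers. The first kind is encoded by at most \<open>t\<close> points and at most
  \<open>2 * g\<close> exceptional sets, the second by a robust family of at most \<open>g\<close>
  sets and again at most \<open>2 * g\<close> exceptional sets.\<close>

lemma kneser_containers:
  fixes X :: "'a set" and k d t :: nat
  defines "V \<equiv> {A. A \<subseteq> X \<and> card A = k}"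
  defines "E \<equiv> {(A, B). A \<in> V \<and> B \<in> V \<and> A \<inter> B = {}}"
  defines "g \<equiv> (8 * k * d) ^ t"
  assumes X: "finite X" "0 < k" "k \<le> card X" and pos: "0 < d" "0 < t"
  shows "\<exists>\<K>. finite \<K> \<and>
    card \<K> \<le> (card X + 1) ^ t * (card V + 1) ^ (2 * g) + (card V + 1) ^ (3 * g) \<and>
    (\<forall>K \<in> \<K>. K \<subseteq> V) \<and> (\<forall>K \<in> \<K>. real (card K) \<le>
      max (real t * (real k / real (card X))) ((2 * real k ^ 2 / real (card X)) ^ t) * real (card V)
        + 2 * real g) \<and>
    (\<forall>F \<subseteq> V. (\<forall>U \<subseteq> F. card (E \<inter> U \<times> U) \<le> 2 * d * card U) \<longrightarrow> (\<exists>K \<in> \<K>. F \<subseteq> K))"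
proof -
  \<comment> \<open>This makes the degree threshold \<open>2 * d\<close> of
    \<open>card_high_degree_le\<close> equal to \<open>m / 2\<close>, the threshold in
    \<open>lowdeg\<close>.\<close>
  define m where "m = 4 * d"
  have m: "0 < m" "(2 * k * m) ^ t = g" using pos by (auto simp: m_def g_def mult.assoc power_mult_distrib)
  have finV: "finite V" using X by (simp add: V_def)
  have cardV: "card V = card X choose k" using X by (simp add: V_def n_subsets)
  have Xne: "X \<noteq> {}" using X by auto
  have V: "finite A \<and> card A \<le> k" if "A \<in> V" for A
    using that X finite_subset by (auto simp: V_def)
  define smallV where "smallV j = {Y. Y \<subseteq> V \<and> card Y \<le> j}" for j
  define smallX where "smallX = {S. S \<subseteq> X \<and> card S \<le> t}"
  define robust where "robust G \<longleftrightarrow> (\<forall>S. finite S \<longrightarrow> card S < t \<longrightarrow> m \<le> card {M \<in> G. M \<inter> S = {}})"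
    for G :: "'a set set"
  define star where "star S = {A. A \<subseteq> X \<and> card A = k \<and> A \<inter> S \<noteq> {}}" for S
  define lowdeg where "lowdeg G = {A. A \<subseteq> X \<and> card A = k \<and> 2 * card {M \<in> G. M \<inter> A = {}} \<le> m}" for G
  define \<K>1 where "\<K>1 = (\<lambda>(S, Y). star S \<union> Y) ` (smallX \<times> smallV (2 * g))"
  define \<K>2 where "\<K>2 = (\<lambda>(G, Y). lowdeg G \<union> Y) ` ({G \<in> smallV g. robust G} \<times> smallV (2 * g))"
  have fin: "finite smallX" "finite (smallV j)" for j
    using X finV by (simp_all add: smallX_def smallV_def)
  have small: "card smallX \<le> (card X + 1) ^ t" "card (smallV j) \<le> (card V + 1) ^ j" for j
    unfolding smallX_def smallV_def using X finV card_small_subsets_le by blast+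
  have "card \<K>1 \<le> card (smallX \<times> smallV (2 * g))"
    unfolding \<K>1_def using fin by (intro card_image_le) auto
  also have "\<dots> \<le> (card X + 1) ^ t * (card V + 1) ^ (2 * g)"
    unfolding card_cartesian_product using small by (intro mult_le_mono)
  finally have K1: "card \<K>1 \<le> (card X + 1) ^ t * (card V + 1) ^ (2 * g)" .
  have "card \<K>2 \<le> card ({G \<in> smallV g. robust G} \<times> smallV (2 * g))"
    unfolding \<K>2_def using fin by (intro card_image_le) auto
  also have "\<dots> \<le> card (smallV g) * card (smallV (2 * g))"
    unfolding card_cartesian_product using fin by (intro mult_le_mono card_mono) auto
  also have "\<dots> \<le> (card V + 1) ^ g * (card V + 1) ^ (2 * g)"
    using small by (intro mult_le_mono)
  also have "\<dots> = (card V + 1) ^ (3 * g)" by (simp flip: power_add)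
  finally have K2: "card \<K>2 \<le> (card V + 1) ^ (3 * g)" .
  let ?\<beta> = "max (real t * (real k / real (card X))) ((2 * real k ^ 2 / real (card X)) ^ t)"
  have size: "real (card (Z \<union> Y)) \<le> ?\<beta> * real (card V) + 2 * real g"
    if "real (card Z) \<le> c * real (card V)" "c \<le> ?\<beta>" "Y \<in> smallV (2 * g)" for Z Y c
  proof -
    have "card (Z \<union> Y) \<le> card Z + 2 * g"
      using card_Un_le[of Z Y] that(3) by (auto simp: smallV_def)
    then have "real (card (Z \<union> Y)) \<le> real (card Z) + 2 * real g" by linarith
    moreover have "c * real (card V) \<le> ?\<beta> * real (card V)"
      using that(2) by (intro mult_right_mono) auto
    ultimately show ?thesis using that(1) by linarith
  qed
  show ?thesis
  proof (intro exI[of _ "\<K>1 \<union> \<K>2"] conjI ballI allI impI)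
    show "finite (\<K>1 \<union> \<K>2)" using fin by (auto simp: \<K>1_def \<K>2_def)
    show "card (\<K>1 \<union> \<K>2) \<le> (card X + 1) ^ t * (card V + 1) ^ (2 * g) + (card V + 1) ^ (3 * g)"
      using K1 K2 card_Un_le[of \<K>1 \<K>2] by linarith
    show "K \<subseteq> V" if "K \<in> \<K>1 \<union> \<K>2" for K
      using that by (auto simp: \<K>1_def \<K>2_def star_def lowdeg_def smallV_def V_def)
  next
    fix K assume "K \<in> \<K>1 \<union> \<K>2"
    then consider S Y where "S \<in> smallX" "Y \<in> smallV (2 * g)" "K = star S \<union> Y"
      | G Y where "G \<in> smallV g" "robust G" "Y \<in> smallV (2 * g)" "K = lowdeg G \<union> Y"
      unfolding \<K>1_def \<K>2_def by blast
    then show "real (card K) \<le> ?\<beta> * real (card V) + 2 * real g"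
    proof cases
      case 1
      then have "finite S" "card S \<le> t" using X finite_subset by (auto simp: smallX_def)
      then have "real (card (star S)) \<le> real t * (real k / real (card X)) * real (card V)"
        unfolding star_def cardV using X Xne by (intro card_star_le)
      then show ?thesis unfolding 1(3) using 1(2) by (intro size[OF _ max.cobounded1])
    next
      case 2
      have "real (card (lowdeg G)) \<le> (2 * real k ^ 2 / real (card X)) ^ t * real (card V)"
        unfolding lowdeg_def cardV
      proof (rule card_mostly_intersecting_le)
        show "finite G" using 2 finV finite_subset by (auto simp: smallV_def)
        show "finite M \<and> card M \<le> k" if "M \<in> G" for M
          using that V 2 by (auto simp: smallV_def)
        show "m \<le> card {M \<in> G. M \<inter> S = {}}" if "finite S" "card S < t" for S
          using that 2 by (auto simp: robust_def)
      qed (use X Xne m in auto)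
      then show ?thesis unfolding 2(4) using 2(3) by (intro size[OF _ max.cobounded2])
    qed
  next
    fix F assume F: "F \<subseteq> V" "\<forall>U \<subseteq> F. card (E \<inter> U \<times> U) \<le> 2 * d * card U"
    have finF: "finite F" using F finV finite_subset by blast
    show "\<exists>K \<in> \<K>1 \<union> \<K>2. F \<subseteq> K"
    proof (cases "robust F")
      case False
      then obtain S where S: "finite S" "card S < t" "card {M \<in> F. M \<inter> S = {}} < m"
        by (auto simp: robust_def not_le)
      let ?Y = "{M \<in> F. M \<inter> S = {}}"
      \<comment> \<open>Members of \<open>F\<close> lie in \<open>X\<close>, so only
        \<open>S \<inter> X\<close> matters, and this leaves finitely many choices.\<close>
      have "card (S \<inter> X) \<le> card S" using S by (intro card_mono) auto
      then have "S \<inter> X \<in> smallX" using S by (auto simp: smallX_def)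
      moreover have "?Y \<in> smallV (2 * g)"
      proof -
        \<comment> \<open>Fewer than \<open>m\<close> sets are left over, and \<open>0 < t\<close>
          gives \<open>m \<le> g\<close>.\<close>
        have "m \<le> (2 * k * m) ^ 1" using X by simp
        also have "\<dots> \<le> (2 * k * m) ^ t" using X pos m by (intro power_increasing) auto
        finally show ?thesis using S(3) F(1) m(2) by (auto simp: smallV_def)
      qed
      moreover have "F \<subseteq> star (S \<inter> X) \<union> ?Y"
        using F(1) unfolding star_def V_def by blast
      ultimately show ?thesis unfolding \<K>1_def by blast
    next
      case True
      have "\<exists>G \<subseteq> F. finite G \<and> card G \<le> (2 * k * m) ^ t \<and>
          (\<forall>S. finite S \<longrightarrow> card S < t \<longrightarrow> m \<le> card {M \<in> G. M \<inter> S = {}})"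
        using X m V F(1) True by (intro robust_subfamily) (auto simp: robust_def)
      then obtain G where G: "G \<subseteq> F" "finite G" "card G \<le> g" "robust G"
        unfolding robust_def m(2) by blast
      define Y where "Y = {A \<in> F - G. 2 * d < card {M \<in> G. (A, M) \<in> E}}"
      have "card Y \<le> card G"
      proof (rule card_high_degree_le[OF finF G(1) _ _ Y_def])
        show "sym E" by (auto simp: E_def sym_def)
        show "card (E \<inter> (G \<union> Y) \<times> (G \<union> Y)) \<le> 2 * d * card (G \<union> Y)"
          using F(2) G(1) by (auto simp: Y_def)
      qed
      then have "card (G \<union> Y) \<le> 2 * g" using card_Un_le[of G Y] G(3) by linarith
      then have "G \<union> Y \<in> smallV (2 * g)" using G F(1) by (auto simp: smallV_def Y_def)
      moreover have "G \<in> smallV g" using G F(1) by (auto simp: smallV_def)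
      \<comment> \<open>\<open>Y\<close> was taken outside \<open>G\<close>, so \<open>G\<close>
        itself joins the exceptional sets; a member of \<open>F\<close> outside both is disjoint
        from at most \<open>2 * d\<close> members of \<open>G\<close>.\<close>
      moreover have "F \<subseteq> lowdeg G \<union> (G \<union> Y)"
      proof
        fix A assume A: "A \<in> F"
        have "{M \<in> G. (A, M) \<in> E} = {M \<in> G. M \<inter> A = {}}"
          using A G(1) F(1) by (auto simp: E_def)
        then show "A \<in> lowdeg G \<union> (G \<union> Y)"
          using A F(1) by (auto simp: lowdeg_def Y_def V_def m_def)
      qed
      ultimately show ?thesis using G(4) unfolding \<K>2_def by blast
    qed
  qed
qed

section \<open>Random lists\<close>

text \<open>Withdrawing one of \<open>n\<close> colours divides the number of
  \<open>r\<close>-subsets by \<open>n / (n - r)\<close>, which stays at most 4 in the allowed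
  range. So a random \<open>r\<close>-subset of \<open>2 * r\<close> colours misses \<open>t\<close>
  given ones with probability at least 1 in \<open>4 ^ t\<close>.\<close>

lemma central_binomial_le:
  assumes "3 * t \<le> 2 * r"
  shows "(2 * r) choose r \<le> 4 ^ t * ((2 * r - t) choose r)"
  using assms
proof (induction t)
  case (Suc t)
  let ?n = "2 * r - t"
  have n: "0 < ?n" "?n \<le> 4 * (?n - r)" using Suc.prems by auto
  have "?n * (?n choose r) \<le> 4 * (?n - r) * (?n choose r)"
    using n by (intro mult_right_mono) auto
  also have "\<dots> = ?n * (4 * ((?n - 1) choose r))"
    using binomial_absorb_comp[of ?n r] by simp
  finally have "?n choose r \<le> 4 * ((2 * r - Suc t) choose r)"
    using n(1) by simp
  then have "4 ^ t * (?n choose r) \<le> 4 ^ t * (4 * ((2 * r - Suc t) choose r))"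
    by (rule mult_le_mono2)
  moreover have "(2 * r) choose r \<le> 4 ^ t * (?n choose r)" using Suc by simp
  ultimately show ?case by (simp only: power_Suc2 mult.assoc)
qed simp

text \<open>Counting functions in \<open>PiE V R\<close> makes the lists uniform and independent. If
  the claim failed, each of them would be respected by one of the \<open>card \<K> ^ (2 * r)\<close>
  assignments \<open>\<kappa>\<close> of containers to colours. One assignment respects at most a
  fraction \<open>exp (- (q * N / 2))\<close> with \<open>q = 1 / 4 ^ s\<close>, too little in view
  of \<open>union\<close>.\<close>

lemma ex_lists_avoiding_containers:
  fixes V :: "'a set" and \<K> :: "'a set set" and r s :: nat
  assumes V: "finite V" and \<K>: "finite \<K>" "\<K> \<noteq> {}" "\<And>K. K \<in> \<K> \<Longrightarrow> K \<subseteq> V"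
    "\<And>K. K \<in> \<K> \<Longrightarrow> real (card K) \<le> \<beta> * real (card V)"
    and s: "3 * s \<le> 2 * r" "4 * real r * \<beta> \<le> real s + 1"
    and union: "4 * real r * 4 ^ s * ln (real (card \<K>)) < real (card V)"
  shows "\<exists>L. (\<forall>A \<in> V. L A \<subseteq> {1..2 * r} \<and> card (L A) = r) \<and>
    (\<forall>\<kappa>. (\<forall>c \<in> {1..2 * r}. \<kappa> c \<in> \<K>) \<longrightarrow> (\<exists>A \<in> V. \<forall>c \<in> L A. A \<notin> \<kappa> c))"
proof (rule ccontr)
  assume neg: "\<not> ?thesis"
  define R where "R = {B. B \<subseteq> {1..2 * r} \<and> card B = r}"
  define C where "C = (2 * r) choose r"
  define N where "N = card V"
  define q :: real where "q = 1 / 4 ^ s"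
  have R: "finite R" "card R = C" by (auto simp: R_def C_def n_subsets)
  have C: "0 < C" by (simp add: C_def)
  have q: "0 \<le> q" "q \<le> 1" by (auto simp: q_def)
  define hit where "hit \<kappa> A = {B \<in> R. \<exists>c \<in> B. A \<in> \<kappa> c}" for \<kappa> :: "nat \<Rightarrow> 'a set" and A
  have cover: "PiE V (\<lambda>_. R) \<subseteq> (\<Union>\<kappa> \<in> PiE {1..2 * r} (\<lambda>_. \<K>). PiE V (hit \<kappa>))"
  proof
    fix L assume L: "L \<in> PiE V (\<lambda>_. R)"
    then have "\<forall>A \<in> V. L A \<subseteq> {1..2 * r} \<and> card (L A) = r" by (auto simp: R_def)
    with neg have "\<not> (\<forall>\<kappa>. (\<forall>c \<in> {1..2 * r}. \<kappa> c \<in> \<K>) \<longrightarrow> (\<exists>A \<in> V. \<forall>c \<in> L A. A \<notin> \<kappa> c))"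
      by (intro notI) (erule notE, intro exI[of _ L] conjI)
    then obtain \<kappa> where \<kappa>: "\<forall>c \<in> {1..2 * r}. \<kappa> c \<in> \<K>" "\<forall>A \<in> V. \<exists>c \<in> L A. A \<in> \<kappa> c"
      by blast
    \<comment> \<open>Restricting \<open>\<kappa>\<close> to the colours \<open>1..2 * r\<close>
      makes it extensional, so that finitely many choices remain to be counted.\<close>
    have "L \<in> PiE V (hit (restrict \<kappa> {1..2 * r}))"
    proof (rule PiE_I)
      fix A assume A: "A \<in> V"
      then have LA: "L A \<in> R" using L by blast
      obtain c where "c \<in> L A" "A \<in> \<kappa> c" using \<kappa>(2) A by blast
      moreover have "c \<in> {1..2 * r}" using LA \<open>c \<in> L A\<close> by (auto simp: R_def)
      ultimately have "A \<in> restrict \<kappa> {1..2 * r} c" by simp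
      then show "L A \<in> hit (restrict \<kappa> {1..2 * r}) A" using LA \<open>c \<in> L A\<close> unfolding hit_def by blast
    qed (use L in auto)
    moreover have "restrict \<kappa> {1..2 * r} \<in> PiE {1..2 * r} (\<lambda>_. \<K>)" using \<kappa>(1) by auto
    ultimately show "L \<in> (\<Union>\<kappa> \<in> PiE {1..2 * r} (\<lambda>_. \<K>). PiE V (hit \<kappa>))" by blast
  qed
  have card_hit: "real (card (PiE V (hit \<kappa>))) \<le> real C ^ N * exp (- (q * real N / 2))"
    if \<kappa>: "\<kappa> \<in> PiE {1..2 * r} (\<lambda>_. \<K>)" for \<kappa>
  proof -
    define T where "T A = {c \<in> {1..2 * r}. A \<in> \<kappa> c}" for A
    have \<kappa>_in: "\<kappa> c \<in> \<K>" if "c \<in> {1..2 * r}" for c using \<kappa> that by blast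
    have "card (hit \<kappa> A) + ((2 * r - card (T A)) choose r) = C" for A
    proof -
      let ?miss = "{B. B \<subseteq> {1..2 * r} - T A \<and> card B = r}"
      have "R = hit \<kappa> A \<union> ?miss" unfolding R_def hit_def T_def by blast
      then have "C = card (hit \<kappa> A \<union> ?miss)" using R(2) by simp
      also have "\<dots> = card (hit \<kappa> A) + card ?miss"
      proof (rule card_Un_disjoint)
        show "hit \<kappa> A \<inter> ?miss = {}" unfolding hit_def T_def by blast
      qed (use R in \<open>auto simp: hit_def\<close>)
      finally have "C = card (hit \<kappa> A) + card ?miss" .
      moreover have "card ({1..2 * r} - T A) = 2 * r - card (T A)"
        by (subst card_Diff_subset) (auto simp: T_def)
      ultimately show ?thesis by (simp add: n_subsets)
    qed
    note hit = this
    have hit_le: "real (card (hit \<kappa> A)) \<le> real C * (if card (T A) \<le> s then 1 - q else 1)" for A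
    proof (cases "card (T A) \<le> s")
      case True
      have "(2 * r - s) choose r \<le> (2 * r - card (T A)) choose r"
        using True by (intro binomial_right_mono) simp
      then have "card (hit \<kappa> A) + ((2 * r - s) choose r) \<le> C" using hit[of A] by linarith
      moreover have "real C \<le> 4 ^ s * real ((2 * r - s) choose r)"
        using central_binomial_le[OF s(1)] unfolding C_def
        by (metis of_nat_le_iff of_nat_mult of_nat_numeral of_nat_power)
      then have "real C * q \<le> real ((2 * r - s) choose r)"
        by (simp add: q_def field_simps)
      ultimately show ?thesis using True by (simp add: algebra_simps)
    next
      case False
      then show ?thesis using hit[of A] by simp
    qed
    define H where "H = {A \<in> V. card (T A) \<le> s}"
    \<comment> \<open>Markov's inequality: the \<open>2 * r\<close> containers have total size at
      most \<open>2 * r * \<beta> * N\<close>, which is at most \<open>(s + 1) * N / 2\<close>, so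
      at most half of the vertices lie in more than \<open>s\<close> of them.\<close>
    have half: "real N \<le> 2 * real (card H)"
    proof -
      have finH: "finite H" "H \<subseteq> V" using V by (auto simp: H_def)
      have "real (card (V - H)) * (real s + 1) = real (\<Sum>A \<in> V - H. s + 1)" by (simp add: algebra_simps)
      also have "\<dots> \<le> real (\<Sum>A \<in> V - H. card (T A))"
        by (intro of_nat_mono sum_mono) (auto simp: H_def)
      also have "\<dots> \<le> real (\<Sum>A \<in> V. card (T A))"
        using V by (intro of_nat_mono sum_mono2) auto
      also have "(\<Sum>A \<in> V. card (T A)) = (\<Sum>c \<in> {1..2 * r}. card {A \<in> V. A \<in> \<kappa> c})"
        unfolding T_def by (rule sum_multicount_gen) (use V in auto)
      also have "real \<dots> = (\<Sum>c \<in> {1..2 * r}. real (card (\<kappa> c)))"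
        unfolding of_nat_sum
      proof (rule sum.cong[OF refl])
        fix c assume "c \<in> {1..2 * r}"
        then have "{A \<in> V. A \<in> \<kappa> c} = \<kappa> c" using \<K>(3)[OF \<kappa>_in] by blast
        then show "real (card {A \<in> V. A \<in> \<kappa> c}) = real (card (\<kappa> c))" by simp
      qed
      also have "\<dots> \<le> (\<Sum>c \<in> {1..2 * r}. \<beta> * real N)"
        unfolding N_def by (intro sum_mono \<K>(4) \<kappa>_in)
      also have "\<dots> = (4 * real r * \<beta>) * real N / 2" by simp
      also have "\<dots> \<le> (real s + 1) * real N / 2"
        using s(2) by (intro divide_right_mono mult_right_mono) auto
      finally have "(real s + 1) * (2 * real (card (V - H))) \<le> (real s + 1) * real N" by argo
      then have "2 * real (card (V - H)) \<le> real N" by (simp only: mult_le_cancel_left)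
      moreover have "real (card (V - H)) = real N - real (card H)"
        using card_Diff_subset[OF finH] card_mono[OF V finH(2)] by (simp add: N_def of_nat_diff)
      ultimately show ?thesis by simp
    qed
    have "real (card (PiE V (hit \<kappa>))) = (\<Prod>A \<in> V. real (card (hit \<kappa> A)))"
      using V by (simp add: card_PiE)
    also have "\<dots> \<le> (\<Prod>A \<in> V. real C * (if card (T A) \<le> s then 1 - q else 1))"
      using hit_le by (intro prod_mono) auto
    also have "\<dots> = real C ^ N * (\<Prod>A \<in> V. if card (T A) \<le> s then 1 - q else 1)"
      by (simp add: prod.distrib N_def)
    also have "(\<Prod>A \<in> V. if card (T A) \<le> s then 1 - q else 1) = (1 - q) ^ card H"
      using V by (simp add: prod.If_cases H_def Int_def)
    also have "(1 - q) ^ card H \<le> exp (- q) ^ card H"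
      using q exp_ge_add_one_self[of "- q"] by (intro power_mono) auto
    also have "\<dots> = exp (- (q * real (card H)))" by (simp flip: exp_of_nat_mult add: mult.commute)
    also have "\<dots> \<le> exp (- (q * real N / 2))"
      using mult_left_mono[OF half q(1)] by simp
    finally show ?thesis by (simp add: mult_left_mono)
  qed
  have fin: "finite (PiE {1..2 * r} (\<lambda>_. \<K>))" using \<K> by (intro finite_PiE) auto
  have "real C ^ N = real (card (PiE V (\<lambda>_. R)))" using V R by (simp add: card_PiE N_def)
  also have "\<dots> \<le> real (card (\<Union>\<kappa> \<in> PiE {1..2 * r} (\<lambda>_. \<K>). PiE V (hit \<kappa>)))"
    using fin V R \<K>(1) by (intro of_nat_mono card_mono cover finite_UN_I finite_PiE) (auto simp: hit_def)
  also have "\<dots> \<le> real (\<Sum>\<kappa> \<in> PiE {1..2 * r} (\<lambda>_. \<K>). card (PiE V (hit \<kappa>)))"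
    by (intro of_nat_mono card_UN_le fin)
  also have "\<dots> \<le> (\<Sum>\<kappa> \<in> PiE {1..2 * r} (\<lambda>_. \<K>). real C ^ N * exp (- (q * real N / 2)))"
    unfolding of_nat_sum by (intro sum_mono card_hit)
  also have "\<dots> = real C ^ N * (real (card \<K>) ^ (2 * r) * exp (- (q * real N / 2)))"
    by (simp add: card_PiE)
  finally have "real C ^ N * 1 \<le> real C ^ N * (real (card \<K>) ^ (2 * r) * exp (- (q * real N / 2)))"
    by simp
  then have "1 \<le> real (card \<K>) ^ (2 * r) * exp (- (q * real N / 2))"
    using C by (simp only: mult_le_cancel_left) simp
  also have "real (card \<K>) ^ (2 * r) = exp (2 * real r * ln (real (card \<K>)))"
  proof -
    have "0 < real (card \<K>)" using \<K> by (simp add: card_gt_0_iff)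
    then show ?thesis by (simp add: exp_of_nat_mult[of "2 * r", simplified])
  qed
  also have "\<dots> * exp (- (q * real N / 2)) = exp (2 * real r * ln (real (card \<K>)) - q * real N / 2)"
    by (simp flip: exp_add)
  finally have "q * real N \<le> 4 * real r * ln (real (card \<K>))" by simp
  then show False using union by (simp add: q_def N_def field_simps)
qed

section \<open>List dichromatic numbers of Kneser graphs\<close>

text \<open>Surplus colours can be discarded from the lists. Failure at \<open>r\<close> thus
  excludes every smaller list size too.\<close>

lemma list_dicolourable_mono:
  assumes "list_dicolourable D r" "r \<le> r'"
  shows "list_dicolourable D r'"
  unfolding list_dicolourable_def
proof (intro allI impI)
  fix L assume L: "list_assignment D r' L"
  have "\<exists>B \<subseteq> L v. card B = r \<and> finite B" if "v \<in> verts D" for v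
    using L that assms(2) obtain_subset_with_card_n[of r "L v"]
    by (metis list_assignment_def)
  then obtain L' where L': "\<forall>v \<in> verts D. L' v \<subseteq> L v \<and> card (L' v) = r \<and> finite (L' v)"
    by metis
  then have "list_assignment D r L'"
    using L by (fastforce simp: list_assignment_def)
  then obtain f where "accepts D L' f" "proper_dicolouring D f"
    using assms(1) by (auto simp: list_dicolourable_def)
  then show "\<exists>f. accepts D L f \<and> proper_dicolouring D f"
    using L' by (auto simp: accepts_def)
qed

text \<open>Lists as long as the number of vertices always suffice, so the \<open>LEAST\<close> is
  attained and by monotonicity exceeds \<open>r\<close>; the \<open>Max\<close> ranges over finitely
  many orientations.\<close>

lemma less_graph_list_dichromatic_number:
  assumes G: "pair_graph G" and D: "orientation G D" and r: "\<not> list_dicolourable (with_proj D) r"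
  shows "r < graph_list_dichromatic_number G"
proof -
  interpret pair_graph G by fact
  have arcs: "parcs D \<subseteq> parcs G" "pverts D = pverts G"
    using D by (auto simp: orientation_def)
  have "loopfree_digraph (with_proj D)"
  proof
    fix e assume "e \<in> arcs (with_proj D)"
    then have e: "e \<in> parcs G" using arcs by auto
    then show "tail (with_proj D) e \<in> verts (with_proj D)" "head (with_proj D) e \<in> verts (with_proj D)"
      "tail (with_proj D) e \<noteq> head (with_proj D) e"
      using arcs(2) in_arcsD1[of "fst e" "snd e"] in_arcsD2[of "fst e" "snd e"] pair_no_loops[OF e]
      by simp_all
  qed
  then have "list_dicolourable (with_proj D) (card (verts (with_proj D)))"
    using arcs pair_finite_verts by (intro list_dicolourable_card_verts) auto
  then have "list_dicolourable (with_proj D) (list_dichromatic_number (with_proj D))"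
    unfolding list_dichromatic_number_def by (rule LeastI)
  then have "r < list_dichromatic_number (with_proj D)"
    using r list_dicolourable_mono not_le by blast
  also have "\<dots> \<le> graph_list_dichromatic_number G"
    unfolding graph_list_dichromatic_number_def
  proof (rule Max_ge)
    show "finite {list_dichromatic_number (with_proj D) |D. orientation G D}"
      using finite_orientations[OF G] by simp
  qed (use D in blast)
  finally show ?thesis .
qed

text \<open>Passes from cycles as arc walks, in which proper colourings are phrased, to acyclic
  relations: a loop in the transitive closure is a closed walk, and that contains a cycle.\<close>

lemma acyclic_if_no_cycle:
  assumes "wf_digraph (with_proj D)"
    and "\<not> (\<exists>p. pre_digraph.cycle (with_proj D \<restriction> F) p)"
  shows "acyclic (parcs D \<inter> F \<times> F)"
proof (rule ccontr)
  interpret wf_digraph "with_proj D \<restriction> F"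
    using assms(1) by (rule wf_digraph.wellformed_induce_subgraph)
  have ends: "arcs_ends (with_proj D \<restriction> F) = parcs D \<inter> F \<times> F"
    by (auto simp: arcs_ends_conv)
  assume "\<not> acyclic (parcs D \<inter> F \<times> F)"
  then obtain u where "(u, u) \<in> (arcs_ends (with_proj D \<restriction> F))\<^sup>+"
    by (auto simp: acyclic_def ends)
  then obtain p where "awalk u p u" "p \<noteq> []"
    by (auto simp: reachable1_awalk)
  then have "closed_w p" by (auto simp: closed_w_def)
  then show False using closed_w_imp_cycle assms(2) by blast
qed

text \<open>The combinatorial core, with free parameters. In a proper colouring, each colour class
  and all its subsets are acyclic, hence sparse, so the class lies in a container. The lists leave
  some vertex outside the containers of all its admissible colours, contradicting the colour it
  receives.\<close>

lemma less_graph_list_dichromatic_number_kneser: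
  fixes n k d t r s :: nat and \<beta> :: real
  defines "N \<equiv> n choose k" and "g \<equiv> (8 * k * d) ^ t"
  assumes k: "0 < k" "k \<le> n" and d: "2 * N \<le> 2 ^ d" and t: "0 < t"
    and \<beta>: "max (real t * (real k / real n)) ((2 * real k ^ 2 / real n) ^ t) * real N + 2 * real g
      \<le> \<beta> * real N"
    and s: "3 * s \<le> 2 * r" "4 * real r * \<beta> \<le> real s + 1"
    and union: "4 * real r * 4 ^ s * ln (real ((n + 1) ^ t * (N + 1) ^ (2 * g) + (N + 1) ^ (3 * g))) < real N"
  shows "r < graph_list_dichromatic_number (kneser_graph n k)"
proof -
  let ?G = "kneser_graph n k"
  define V where "V = {A. A \<subseteq> {1..n} \<and> card A = k}"
  define E where "E = {(A, B). A \<in> V \<and> B \<in> V \<and> A \<inter> B = {}}"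
  have G: "pverts ?G = V" "parcs ?G = E" by (auto simp: kneser_graph_def V_def E_def)
  have V: "finite V" "card V = N" by (auto simp: V_def N_def n_subsets)
  have "0 < N" using k by (simp add: N_def)
  then have "0 < d" using d by (cases d) auto
  have E: "E \<subseteq> V \<times> V" "sym E" by (auto simp: E_def sym_def)
  have "irrefl E" using k by (auto simp: E_def irrefl_def V_def)
  then obtain D' where D': "D' \<subseteq> E" "\<forall>(u, v) \<in> E. (u, v) \<in> D' \<longleftrightarrow> (v, u) \<notin> D'"
    "\<And>U. U \<subseteq> V \<Longrightarrow> acyclic (D' \<inter> U \<times> U) \<Longrightarrow> card (E \<inter> U \<times> U) \<le> 2 * d * card U"
    using ex_orientation_sparse_acyclic[OF V(1) E, of d] d V(2) by auto
  define D where "D = \<lparr>pverts = V, parcs = D'\<rparr>"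
  have D: "orientation ?G D" using D' G by (auto simp: orientation_def D_def)
  have wf: "wf_digraph (with_proj D)"
    using D' E by unfold_locales (auto simp: D_def)
  have card_n: "card {1..n} = n" by simp
  obtain \<K> where \<K>: "finite \<K>"
    "card \<K> \<le> (n + 1) ^ t * (N + 1) ^ (2 * g) + (N + 1) ^ (3 * g)"
    "\<forall>K \<in> \<K>. K \<subseteq> V"
    "\<forall>K \<in> \<K>. real (card K) \<le> max (real t * (real k / real n)) ((2 * real k ^ 2 / real n) ^ t) * real N
        + 2 * real g"
    "\<forall>F \<subseteq> V. (\<forall>U \<subseteq> F. card (E \<inter> U \<times> U) \<le> 2 * d * card U) \<longrightarrow> (\<exists>K \<in> \<K>. F \<subseteq> K)"
    using kneser_containers[of "{1..n}" k d t, unfolded card_n, OF finite_atLeastAtMost k \<open>0 < d\<close> t,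
        folded V_def g_def, folded E_def, unfolded V(2)]
    by (elim exE conjE)
  \<comment> \<open>Even the empty family has a container, so \<open>\<K>\<close> is
    nonempty.\<close>
  have "\<exists>K \<in> \<K>. {} \<subseteq> K" using \<K>(5) by (auto dest: spec[of _ "{}"])
  then have ne: "\<K> \<noteq> {}" by blast
  have "\<exists>L. (\<forall>A \<in> V. L A \<subseteq> {1..2 * r} \<and> card (L A) = r) \<and>
      (\<forall>\<kappa>. (\<forall>c \<in> {1..2 * r}. \<kappa> c \<in> \<K>) \<longrightarrow> (\<exists>A \<in> V. \<forall>c \<in> L A. A \<notin> \<kappa> c))"
  proof (rule ex_lists_avoiding_containers[OF V(1) \<K>(1) ne _ _ s])
    have "0 < card \<K>" using \<K>(1) ne by (simp add: card_gt_0_iff)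
    then have "ln (real (card \<K>)) \<le> ln (real ((n + 1) ^ t * (N + 1) ^ (2 * g) + (N + 1) ^ (3 * g)))"
      using \<K>(2) by (subst ln_le_cancel_iff) (simp_all only: of_nat_0_less_iff of_nat_le_iff)
    then have "4 * real r * 4 ^ s * ln (real (card \<K>)) \<le>
        4 * real r * 4 ^ s * ln (real ((n + 1) ^ t * (N + 1) ^ (2 * g) + (N + 1) ^ (3 * g)))"
      by (intro mult_left_mono) auto
    then show "4 * real r * 4 ^ s * ln (real (card \<K>)) < real (card V)"
      using union V(2) by linarith
  qed (use \<K> \<beta> V(2) in \<open>auto intro: order_trans\<close>)
  then obtain L where L: "\<forall>A \<in> V. L A \<subseteq> {1..2 * r} \<and> card (L A) = r"
    "\<forall>\<kappa>. (\<forall>c \<in> {1..2 * r}. \<kappa> c \<in> \<K>) \<longrightarrow> (\<exists>A \<in> V. \<forall>c \<in> L A. A \<notin> \<kappa> c)"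
    by blast
  have "\<not> list_dicolourable (with_proj D) r"
  proof
    assume "list_dicolourable (with_proj D) r"
    moreover have "list_assignment (with_proj D) r L"
      unfolding list_assignment_def
    proof (intro ballI conjI)
      fix A assume "A \<in> verts (with_proj D)"
      then have LA: "L A \<subseteq> {1..2 * r}" "card (L A) = r" using L(1) by (auto simp: D_def)
      show "L A \<subseteq> {1..}" using LA(1) by auto
      show "finite (L A)" using LA(1) finite_subset by blast
      show "card (L A) = r" by (rule LA(2))
    qed
    ultimately obtain f where f: "accepts (with_proj D) L f" "proper_dicolouring (with_proj D) f"
      by (auto simp: list_dicolourable_def)
    define F where "F c = {A \<in> V. f A = c}" for c
    have "\<exists>K \<in> \<K>. F c \<subseteq> K" for c
    proof -
      have "acyclic (parcs D \<inter> F c \<times> F c)"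
        using f(2) wf by (intro acyclic_if_no_cycle) (auto simp: proper_dicolouring_def F_def D_def)
      then have "card (E \<inter> U \<times> U) \<le> 2 * d * card U" if "U \<subseteq> F c" for U
        using that by (intro D'(3)) (auto simp: F_def D_def elim!: acyclic_subset)
      then show ?thesis using \<K>(5) by (auto simp: F_def)
    qed
    then obtain \<kappa> where \<kappa>: "\<And>c. \<kappa> c \<in> \<K>" "\<And>c. F c \<subseteq> \<kappa> c" by metis
    then obtain A where A: "A \<in> V" "\<forall>c \<in> L A. A \<notin> \<kappa> c" using L(2) by blast
    have "f A \<in> L A" using f(1) A(1) by (auto simp: accepts_def D_def)
    moreover have "A \<in> \<kappa> (f A)" using A(1) \<kappa>(2)[of "f A"] by (auto simp: F_def)
    ultimately show False using A(2) by blast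
  qed
  then show ?thesis
    by (rule less_graph_list_dichromatic_number[OF pair_graph_kneser_graph[OF k(1)] D])
qed

section \<open>Choice of parameters\<close>

text \<open>With \<open>y = \<epsilon> * ln n\<close>, this is the convergence of
  \<open>y ^ p / exp y\<close> to 0.\<close>

lemma eventually_ln_power_less_powr:
  fixes C \<epsilon> :: real
  assumes "0 < \<epsilon>"
  shows "eventually (\<lambda>n. C * ln (real n) ^ p < real n powr \<epsilon>) sequentially"
proof -
  have lim: "filterlim (\<lambda>n. \<epsilon> * ln (real n)) at_top sequentially"
    using assms by (intro filterlim_tendsto_pos_mult_at_top[OF tendsto_const]
        filterlim_compose[OF ln_at_top filterlim_real_sequentially])
  have "((\<lambda>n. C / \<epsilon> ^ p * ((\<epsilon> * ln (real n)) ^ p / exp (\<epsilon> * ln (real n)))) \<longlongrightarrow> C / \<epsilon> ^ p * 0) sequentially"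
    by (intro tendsto_mult tendsto_const filterlim_compose[OF tendsto_power_div_exp_0 lim])
  then have "eventually (\<lambda>n. C / \<epsilon> ^ p * ((\<epsilon> * ln (real n)) ^ p / exp (\<epsilon> * ln (real n))) < 1) sequentially"
    by (rule order_tendstoD) simp
  then show ?thesis
    using eventually_gt_at_top[of 0]
  proof eventually_elim
    case (elim n)
    have "C / \<epsilon> ^ p * ((\<epsilon> * ln (real n)) ^ p / exp (\<epsilon> * ln (real n))) = C * ln (real n) ^ p / real n powr \<epsilon>"
      using assms elim(2) by (simp add: powr_def power_mult_distrib)
    with elim(1) have "C * ln (real n) ^ p / real n powr \<epsilon> < 1" by (simp only:)
    then show ?case using elim(2) by (simp add: pos_divide_less_eq)
  qed
qed

text \<open>Keeps later estimates uniform in \<open>k\<close>: it absorbs the factor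
  \<open>k ^ (2 * t)\<close> from \<open>g\<close> and one more \<open>k\<close>. For
  \<open>k \<ge> 2 * t + 3\<close> the exponent may be raised to \<open>k - 2\<close> before using
  \<open>k\<^sup>2 \<le> n\<close>; any smaller \<open>k\<close> is bounded in terms of
  \<open>t\<close>.\<close>

lemma power_le_powr_of_square_le:
  fixes n k t :: nat
  assumes "2 \<le> k" "k\<^sup>2 \<le> n"
  shows "real k ^ (2 * t + 1) \<le> real ((2 * t + 4) ^ (2 * t + 1)) * real n powr ((real k - 2) / 2)"
proof (cases "2 * t + 3 \<le> k")
  case True
  have "real k ^ (2 * t + 1) \<le> real k ^ (k - 2)"
    using True by (intro power_increasing) auto
  also have "\<dots> = (real k powr 2) powr ((real k - 2) / 2)"
  proof -
    have e: "2 * ((real k - 2) / 2) = real (k - 2)" using assms by (simp add: of_nat_diff)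
    have "0 < real k" using assms by simp
    from powr_realpow[OF this, of "k - 2"] show ?thesis unfolding powr_powr e by (rule sym)
  qed
  also have "\<dots> \<le> real n powr ((real k - 2) / 2)"
  proof (intro powr_mono2)
    have "real k powr 2 = real (k\<^sup>2)" using assms by simp
    then show "real k powr 2 \<le> real n" using assms(2) of_nat_le_iff by metis
  qed (use assms in auto)
  also have "\<dots> = 1 * real n powr ((real k - 2) / 2)" by simp
  also have "\<dots> \<le> real ((2 * t + 4) ^ (2 * t + 1)) * real n powr ((real k - 2) / 2)"
  proof (intro mult_right_mono)
    have "1 \<le> (2 * t + 4) ^ (2 * t + 1)" by (rule one_le_power) simp
    then show "1 \<le> real ((2 * t + 4) ^ (2 * t + 1))" by linarith
  qed simp
  finally show ?thesis .
next
  case False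
  have n: "1 \<le> n" using assms by (cases n) auto
  have "k ^ (2 * t + 1) \<le> (2 * t + 4) ^ (2 * t + 1)" using False by (intro power_mono) auto
  then have "real k ^ (2 * t + 1) \<le> real ((2 * t + 4) ^ (2 * t + 1)) * 1"
    by (metis mult.right_neutral of_nat_le_iff of_nat_power)
  also have "\<dots> \<le> real ((2 * t + 4) ^ (2 * t + 1)) * real n powr ((real k - 2) / 2)"
    using assms n by (intro mult_left_mono ge_one_powr_ge_zero) auto
  finally show ?thesis .
qed

text \<open>Both summands are at most \<open>(n + 1) ^ (3 * g * k)\<close>; adding them costs at
  most one more factor \<open>n + 1\<close>, and \<open>n + 1 \<le> n ^ 2\<close> turns the exponent
  \<open>4 * g * k\<close> into \<open>8 * g * k\<close>.\<close>

lemma ln_number_of_containers_le: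
  fixes n k t g N :: nat
  assumes "2 \<le> n" "1 \<le> k" "N \<le> n ^ k" "t \<le> g * k" "1 \<le> g"
  shows "ln (real ((n + 1) ^ t * (N + 1) ^ (2 * g) + (N + 1) ^ (3 * g))) \<le> 8 * real g * real k * ln (real n)"
proof -
  have N: "N + 1 \<le> (n + 1) ^ k"
  proof -
    have "n ^ k < (n + 1) ^ k" using assms(2) by (intro power_strict_mono) auto
    then show ?thesis using assms(3) by linarith
  qed
  have "(n + 1) ^ t * (N + 1) ^ (2 * g) \<le> (n + 1) ^ (g * k) * ((n + 1) ^ k) ^ (2 * g)"
    using assms N by (intro mult_mono power_mono power_increasing) auto
  also have "\<dots> = (n + 1) ^ (3 * g * k)"
    by (simp flip: power_mult power_add add: algebra_simps)
  finally have 1: "(n + 1) ^ t * (N + 1) ^ (2 * g) \<le> (n + 1) ^ (3 * g * k)" .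
  have "(N + 1) ^ (3 * g) \<le> ((n + 1) ^ k) ^ (3 * g)" using N by (intro power_mono) auto
  also have "\<dots> = (n + 1) ^ (3 * g * k)" by (simp flip: power_mult add: algebra_simps)
  finally have "(n + 1) ^ t * (N + 1) ^ (2 * g) + (N + 1) ^ (3 * g) \<le> 2 * (n + 1) ^ (3 * g * k)"
    using 1 by linarith
  also have "\<dots> \<le> (n + 1) * (n + 1) ^ (3 * g * k)" using assms(1) by (intro mult_right_mono) auto
  also have "\<dots> = (n + 1) ^ (3 * g * k + 1)" by simp
  also have "\<dots> \<le> (n + 1) ^ (4 * g * k)"
  proof (intro power_increasing)
    have "1 * 1 \<le> g * k" using assms by (intro mult_le_mono)
    then show "3 * g * k + 1 \<le> 4 * g * k" by simp
  qed simp
  also have "\<dots> \<le> (n ^ 2) ^ (4 * g * k)"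
  proof (intro power_mono)
    have "n + 1 \<le> n * 2" using assms by simp
    also have "\<dots> \<le> n * n" using assms by (intro mult_le_mono2)
    finally show "n + 1 \<le> n ^ 2" by (simp add: power2_eq_square)
  qed simp
  also have "\<dots> = n ^ (8 * g * k)" by (simp flip: power_mult add: mult.assoc)
  finally have le: "(n + 1) ^ t * (N + 1) ^ (2 * g) + (N + 1) ^ (3 * g) \<le> n ^ (8 * g * k)" .
  have "0 < (n + 1) ^ t * (N + 1) ^ (2 * g) + (N + 1) ^ (3 * g)" by simp
  then have "ln (real ((n + 1) ^ t * (N + 1) ^ (2 * g) + (N + 1) ^ (3 * g))) \<le> ln (real (n ^ (8 * g * k)))"
    using le by (intro ln_mono) (simp_all only: of_nat_0_less_iff of_nat_le_iff)
  also have "\<dots> = 8 * real g * real k * ln (real n)"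
    using assms by (simp add: ln_realpow)
  finally show ?thesis .
qed

text \<open>Everything is measured against \<open>n choose k\<close>, which is at least
  \<open>n powr (k / 2 + \<epsilon> * k)\<close>. The choice of \<open>c\<close> lets
  \<open>4 ^ s\<close> cost only \<open>n powr (\<epsilon> * k / 2)\<close>, and by
  \<open>big\<close> the remaining constants and powers of \<open>ln n\<close> cost less than
  \<open>n powr \<epsilon>\<close>, which fits since \<open>k \<ge> 2\<close>.\<close>

lemma kneser_bound_large:
  fixes \<epsilon> :: real and n k t :: nat
  defines "c \<equiv> \<epsilon> / (32 * (real t + 1))"
  assumes \<epsilon>: "0 < \<epsilon>" "\<epsilon> < 1 / 2" "1 \<le> \<epsilon> * real t"
    and k: "2 \<le> k" "real k \<le> real n powr (1 / 2 - \<epsilon>)"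
    and n: "3 \<le> n" "2 ^ t \<le> n" "36 * (t + 1)\<^sup>2 \<le> n" "1 \<le> c * (real n * ln (real n))"
    and big: "64 * 48 ^ t * real ((2 * t + 4) ^ (2 * t + 1)) * ln (real n) ^ (t + 2) < real n powr \<epsilon>"
  shows "c * (real n * ln (real n)) \<le> real (graph_list_dichromatic_number (kneser_graph n k))"
proof -
  define x where "x = real n"
  define \<Lambda> where "\<Lambda> = ln x"
  define N where "N = n choose k"
  \<comment> \<open>\<open>2 ^ l\<close> is at least \<open>n\<close>, so \<open>2 ^ (k * l)\<close>
    is at least \<open>N\<close>; the 1 added in \<open>d\<close> supplies the factor 2 in
    \<open>2 * N \<le> 2 ^ d\<close>.\<close>
  define l where "l = nat \<lceil>log 2 x\<rceil>"
  define d where "d = k * l + 1"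
  define g where "g = (8 * k * d) ^ t"
  define r where "r = nat \<lceil>c * (x * \<Lambda>)\<rceil>"
  \<comment> \<open>\<open>t * k / x\<close> bounds the main part of a container; the extra
    \<open>k / x\<close> is room for its \<open>2 * g\<close> exceptional sets.\<close>
  define \<beta> where "\<beta> = (real t + 1) * real k / x"
  define s where "s = nat \<lfloor>4 * real r * \<beta>\<rfloor>"
  define K where "K = real ((2 * t + 4) ^ (2 * t + 1))"
  have x: "3 \<le> x" using n by (simp add: x_def)
  have t: "0 < t" using \<epsilon> by (cases t) auto
  have \<Lambda>: "1 \<le> \<Lambda>"
  proof -
    have "exp 1 \<le> x" using exp_le x by linarith
    then show ?thesis unfolding \<Lambda>_def using x by (subst ln_ge_iff) auto
  qed
  have ksq: "real k ^ 2 \<le> x powr (1 - 2 * \<epsilon>)"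
  proof -
    have "real k ^ 2 \<le> (x powr (1 / 2 - \<epsilon>)) ^ 2" using k by (intro power_mono) (auto simp: x_def)
    also have "\<dots> = x powr ((1 / 2 - \<epsilon>) * 2)" using x by (simp add: powr_powr flip: powr_numeral)
    finally show ?thesis by (simp add: algebra_simps)
  qed
  have ksq': "real k ^ 2 \<le> x"
  proof -
    have "x powr (1 - 2 * \<epsilon>) \<le> x powr 1" using x \<epsilon> by (intro powr_mono) auto
    then show ?thesis using ksq x by simp
  qed
  then have ksqn: "k\<^sup>2 \<le> n" unfolding x_def by (metis of_nat_le_iff of_nat_power)
  have kn: "k \<le> n" using ksqn k by (metis le_trans power2_nat_le_imp_le le_square power2_eq_square)
  have N_le: "N \<le> n ^ k" unfolding N_def using kn by (rule binomial_le_pow)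
  \<comment> \<open>From \<open>(n / k) ^ k \<le> N\<close> and
    \<open>n powr (1 / 2 + \<epsilon>) \<le> n / k\<close>.\<close>
  have N_ge: "x powr (real k / 2 + \<epsilon> * real k) \<le> real N"
  proof -
    have "x powr (1 / 2 + \<epsilon>) * real k \<le> x powr (1 / 2 + \<epsilon>) * x powr (1 / 2 - \<epsilon>)"
      using k by (intro mult_left_mono) (auto simp: x_def)
    also have "\<dots> = x" using x by (simp flip: powr_add)
    finally have "x powr (1 / 2 + \<epsilon>) \<le> x / real k" using k by (simp add: field_simps)
    then have "(x powr (1 / 2 + \<epsilon>)) ^ k \<le> (x / real k) ^ k" by (intro power_mono) auto
    also have "\<dots> \<le> real N" unfolding N_def x_def by (rule binomial_ge_n_over_k_pow_k[OF kn])
    finally show ?thesis using x by (simp add: powr_powr algebra_simps flip: powr_realpow)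
  qed
  have l: "n \<le> 2 ^ l" "real l \<le> 3 * \<Lambda>" "1 \<le> l"
  proof -
    have pos: "0 < log 2 x" using x by simp
    have "log 2 x \<le> real l" unfolding l_def by linarith
    then have "2 powr (log 2 x) \<le> 2 powr (real l)" by (intro powr_mono) auto
    then have "x \<le> 2 ^ l" using x by (simp add: powr_realpow)
    then show "n \<le> 2 ^ l" unfolding x_def by (metis of_nat_le_iff of_nat_numeral of_nat_power)
    have "1 / 2 \<le> ln (2 :: real)" using ln_le_minus_one[of "1 / 2"] by (simp add: ln_div)
    then have "log 2 x * (1 / 2) \<le> log 2 x * ln 2"
      using pos by (intro mult_left_mono) auto
    also have "\<dots> = \<Lambda>" by (simp add: log_def \<Lambda>_def)
    finally have "log 2 x \<le> 2 * \<Lambda>" by simp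
    moreover have "real l \<le> log 2 x + 1" unfolding l_def using pos by linarith
    ultimately show "real l \<le> 3 * \<Lambda>" using \<Lambda> by linarith
    show "1 \<le> l" unfolding l_def using pos by linarith
  qed
  have d2: "2 * N \<le> 2 ^ d"
  proof -
    have "N \<le> (2 ^ l) ^ k" using N_le power_mono[OF l(1), of k] by linarith
    then show ?thesis by (simp add: d_def power_mult mult.commute[of k l])
  qed
  have g_le: "real g \<le> 48 ^ t * real k ^ (2 * t) * \<Lambda> ^ t"
  proof -
    have "1 * 1 \<le> k * l" using k l by (intro mult_le_mono) auto
    then have "8 * k * d \<le> 8 * k * (2 * (k * l))" by (intro mult_le_mono2) (simp add: d_def)
    then have "real (8 * k * d) \<le> real (8 * k * (2 * (k * l)))" using of_nat_le_iff by blast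
    also have "\<dots> = 16 * real k ^ 2 * real l" by (simp add: power2_eq_square)
    also have "\<dots> \<le> 16 * real k ^ 2 * (3 * \<Lambda>)" using l by (intro mult_left_mono) auto
    finally have "real (8 * k * d) \<le> 48 * real k ^ 2 * \<Lambda>" by simp
    then have "real (8 * k * d) ^ t \<le> (48 * real k ^ 2 * \<Lambda>) ^ t" by (intro power_mono) auto
    then show ?thesis by (simp add: g_def power_mult_distrib power_mult)
  qed
  have g1: "t \<le> g * k" "1 \<le> g"
  proof -
    have "2 ^ t \<le> g" unfolding g_def using k by (intro power_mono) (auto simp: d_def)
    then have "t \<le> g" using less_exp[of t] by linarith
    also have "g * 1 \<le> g * k" using k by (intro mult_le_mono2) auto
    finally show "t \<le> g * k" by simp
    show "1 \<le> g" using \<open>t \<le> g\<close> t by linarith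
  qed
  \<comment> \<open>The place where \<open>big\<close> enters; the result serves both the
    exceptional sets and the union bound.\<close>
  have main: "64 * real g * x * real k * \<Lambda> ^ 2 < x powr (\<epsilon> + real k / 2)"
  proof -
    have "64 * real g * x * real k * \<Lambda> ^ 2 = real g * (64 * x * real k * \<Lambda> ^ 2)" by simp
    also have "\<dots> \<le> (48 ^ t * real k ^ (2 * t) * \<Lambda> ^ t) * (64 * x * real k * \<Lambda> ^ 2)"
      using g_le x by (intro mult_right_mono) auto
    also have "\<dots> = (64 * 48 ^ t * \<Lambda> ^ (t + 2) * x) * real k ^ (2 * t + 1)"
      by (simp add: power_add power2_eq_square)
    also have "\<dots> \<le> (64 * 48 ^ t * \<Lambda> ^ (t + 2) * x) * (K * x powr ((real k - 2) / 2))"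
      unfolding K_def x_def using power_le_powr_of_square_le[OF k(1) ksqn, of t] \<Lambda>
      by (intro mult_left_mono) (auto simp: x_def)
    also have "\<dots> = (64 * 48 ^ t * K * \<Lambda> ^ (t + 2)) * (x powr 1 * x powr ((real k - 2) / 2))"
      using x by simp
    also have "x powr 1 * x powr ((real k - 2) / 2) = x powr (real k / 2)"
      unfolding powr_add[symmetric] by (rule arg_cong[where f = "\<lambda>y. x powr y"]) argo
    also have "(64 * 48 ^ t * K * \<Lambda> ^ (t + 2)) * x powr (real k / 2) < x powr \<epsilon> * x powr (real k / 2)"
      using big x by (intro mult_strict_right_mono) (auto simp: K_def \<Lambda>_def x_def)
    finally show ?thesis by (simp add: powr_add)
  qed
  have c: "0 < c" "c \<le> 1" using \<epsilon> by (auto simp: c_def field_simps)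
  have r: "c * (x * \<Lambda>) \<le> real r" "real r \<le> 2 * c * x * \<Lambda>"
  proof -
    show "c * (x * \<Lambda>) \<le> real r" unfolding r_def by linarith
    have "1 \<le> c * (x * \<Lambda>)" using n(4) by (simp add: x_def \<Lambda>_def)
    then have "real r \<le> 2 * (c * (x * \<Lambda>))" unfolding r_def by linarith
    then show "real r \<le> 2 * c * x * \<Lambda>" by simp
  qed
  have \<beta>0: "0 \<le> 4 * real r * \<beta>" using x by (auto simp: \<beta>_def)
  have s: "real s \<le> 4 * real r * \<beta>" "4 * real r * \<beta> \<le> real s + 1"
    using \<beta>0 unfolding s_def by linarith+
  \<comment> \<open>It is enough that \<open>6 * \<beta> \<le> 1\<close>, which follows from
    \<open>36 * (t + 1)\<^sup>2 \<le> n\<close> and \<open>k\<^sup>2 \<le> n\<close>.\<close>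
  have s3: "3 * s \<le> 2 * r"
  proof -
    have "(6 * ((real t + 1) * real k))\<^sup>2 = real (36 * (t + 1)\<^sup>2) * real k ^ 2"
      by (simp add: power_mult_distrib)
    also have "\<dots> \<le> x * x"
      using n(3) ksq' by (intro mult_mono) (simp_all only: x_def of_nat_le_iff, simp_all)
    finally have "(6 * ((real t + 1) * real k))\<^sup>2 \<le> x\<^sup>2" by (simp add: power2_eq_square)
    then have "6 * ((real t + 1) * real k) \<le> x" by (rule power2_le_imp_le) (use x in simp)
    then have "6 * \<beta> \<le> 1" using x by (simp add: \<beta>_def field_simps)
    then have "real r * (6 * \<beta>) \<le> real r * 1" by (intro mult_left_mono) auto
    then have "3 * real s \<le> 2 * real r" using s(1) by linarith
    then show ?thesis by linarith
  qed
  \<comment> \<open>\<open>s\<close> is at most \<open>8 * c * (t + 1) * k * \<Lambda>\<close>,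
    which the 32 in \<open>c\<close> turns into \<open>\<epsilon> * k * \<Lambda> / 4\<close>;
    replacing 4 by \<open>exp 2\<close> doubles this in the exponent.\<close>
  have four_s: "4 ^ s \<le> x powr (\<epsilon> * real k / 2)"
  proof -
    have "0 \<le> \<beta>" using x by (simp add: \<beta>_def)
    then have "4 * real r * \<beta> \<le> 4 * (2 * c * x * \<Lambda>) * \<beta>"
      using r(2) by (intro mult_right_mono mult_left_mono) (assumption | simp)+
    with s(1) have "real s \<le> 4 * (2 * c * x * \<Lambda>) * \<beta>" by linarith
    also have "\<dots> = 8 * (c * (real t + 1)) * real k * \<Lambda>"
      using x by (simp add: \<beta>_def)
    also have "c * (real t + 1) = \<epsilon> / 32"
    proof -
      have "\<epsilon> / (32 * u) * u = \<epsilon> / 32" if "u \<noteq> 0" for u :: real using that by simp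
      moreover have "real t + 1 \<noteq> 0" by linarith
      ultimately show ?thesis unfolding c_def by blast
    qed
    finally have s4: "2 * real s \<le> \<epsilon> * real k / 2 * \<Lambda>" by simp
    have "(4::real) \<le> exp 1 ^ 2"
    proof -
      have "(2::real) ^ 2 \<le> exp 1 ^ 2" using exp_ge_add_one_self[of 1] by (intro power_mono) auto
      then show ?thesis by simp
    qed
    then have "4 ^ s \<le> (exp 1 ^ 2 :: real) ^ s" by (intro power_mono) auto
    also have "\<dots> = exp (2 * real s)"
      by (simp flip: power_mult exp_of_nat_mult)
    also have "\<dots> \<le> exp (\<epsilon> * real k / 2 * \<Lambda>)" using s4 by simp
    also have "\<dots> = x powr (\<epsilon> * real k / 2)" using x by (simp add: powr_def \<Lambda>_def)
    finally show ?thesis .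
  qed
  have "r < graph_list_dichromatic_number (kneser_graph n k)"
  proof (rule less_graph_list_dichromatic_number_kneser[of k n d t \<beta> s r, folded N_def g_def])
    show "max (real t * (real k / real n)) ((2 * (real k)\<^sup>2 / real n) ^ t) * real N + 2 * real g \<le> \<beta> * real N"
    proof -
      \<comment> \<open>Since \<open>\<epsilon> * t \<ge> 1\<close>, the second entry of the maximum
        is at most \<open>2 ^ t / x\<^sup>2\<close>, thus at most \<open>1 / x\<close>, and the
        first entry dominates.\<close>
      have "(2 * (real k)\<^sup>2 / x) ^ t \<le> (2 * x powr (- 2 * \<epsilon>)) ^ t"
      proof (intro power_mono)
        have "(real k)\<^sup>2 / x \<le> x powr (1 - 2 * \<epsilon>) / x powr 1" using ksq x by (simp add: divide_right_mono)
        also have "\<dots> = x powr (- 2 * \<epsilon>)" unfolding powr_diff[symmetric] by simp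
        finally show "2 * (real k)\<^sup>2 / x \<le> 2 * x powr (- 2 * \<epsilon>)"
          unfolding times_divide_eq_right[symmetric] by (intro mult_left_mono) auto
      qed (use x in auto)
      also have "\<dots> = 2 ^ t * x powr (- 2 * (\<epsilon> * real t))"
        using x by (simp add: power_mult_distrib powr_powr mult.assoc flip: powr_realpow)
      also have "\<dots> \<le> x * x powr (- 2)"
      proof (intro mult_mono powr_mono)
        have "real (2 ^ t) \<le> x" using n(2) unfolding x_def of_nat_le_iff .
        then show "2 ^ t \<le> x" by simp
      qed (use x \<epsilon> in auto)
      also have "\<dots> = 1 / x" using x by (simp add: powr_minus power2_eq_square field_simps)
      also have "\<dots> \<le> real t * (real k / x)"
      proof -
        have "1 * 1 \<le> real t * real k" using t k by (intro mult_mono) auto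
        then show ?thesis using x by (simp add: field_simps)
      qed
      finally have max: "max (real t * (real k / x)) ((2 * (real k)\<^sup>2 / x) ^ t) = real t * (real k / x)"
        by simp
      have "2 * real g * x \<le> 64 * real g * x * real k * \<Lambda> ^ 2"
      proof -
        have "1 * 1 \<le> real k * \<Lambda> ^ 2" using k \<Lambda> by (intro mult_mono one_le_power) auto
        then have "2 * real g * x * 1 \<le> 64 * real g * x * (real k * \<Lambda> ^ 2)"
          using x by (intro mult_mono) auto
        then show ?thesis by (simp add: mult.assoc)
      qed
      also have "\<dots> \<le> x powr (\<epsilon> + real k / 2)" using main by simp
      also have "\<dots> \<le> x powr (real k / 2 + \<epsilon> * real k)"
        using x k \<epsilon> by (intro powr_mono) auto
      also have "\<dots> \<le> real N" by (rule N_ge)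
      also have "real N = 1 * real N" by simp
      also have "\<dots> \<le> real k * real N" using k by (intro mult_right_mono) auto
      finally have "2 * real g \<le> real k * real N / x" using x by (simp add: field_simps)
      then show ?thesis
        unfolding x_def[symmetric] max \<beta>_def by (simp add: algebra_simps add_divide_distrib)
    qed
    show "4 * real r * 4 ^ s * ln (real ((n + 1) ^ t * (N + 1) ^ (2 * g) + (N + 1) ^ (3 * g))) < real N"
    proof -
      have "4 * real r * 4 ^ s * ln (real ((n + 1) ^ t * (N + 1) ^ (2 * g) + (N + 1) ^ (3 * g)))
          \<le> 4 * real r * 4 ^ s * (8 * real g * real k * \<Lambda>)"
        using n(1) k(1) N_le g1 unfolding \<Lambda>_def x_def
        by (intro mult_left_mono ln_number_of_containers_le) auto
      also have "\<dots> \<le> 4 * (2 * c * x * \<Lambda>) * x powr (\<epsilon> * real k / 2) * (8 * real g * real k * \<Lambda>)"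
        using r(2) four_s x c \<Lambda> by (intro mult_mono) auto
      also have "\<dots> = c * (64 * real g * x * real k * \<Lambda> ^ 2) * x powr (\<epsilon> * real k / 2)"
        by (simp add: power2_eq_square)
      also have "\<dots> \<le> 1 * (64 * real g * x * real k * \<Lambda> ^ 2) * x powr (\<epsilon> * real k / 2)"
        using c x by (intro mult_right_mono) auto
      also have "\<dots> < x powr (\<epsilon> + real k / 2) * x powr (\<epsilon> * real k / 2)"
        using main x by (intro mult_strict_right_mono) auto
      also have "\<dots> = x powr (\<epsilon> + real k / 2 + \<epsilon> * real k / 2)" by (simp add: powr_add)
      also have "\<dots> \<le> x powr (real k / 2 + \<epsilon> * real k)"
      proof (intro powr_mono)
        have "\<epsilon> * 2 \<le> \<epsilon> * real k" using \<epsilon> k by (intro mult_left_mono) auto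
        then show "\<epsilon> + real k / 2 + \<epsilon> * real k / 2 \<le> real k / 2 + \<epsilon> * real k" by simp
      qed (use x in auto)
      also have "\<dots> \<le> real N" by (rule N_ge)
      finally show ?thesis .
    qed
  qed (use k kn d2 t s s3 in auto)
  then show ?thesis using r(1) by (simp add: x_def \<Lambda>_def)
qed

theorem theorem15:
  fixes \<epsilon> :: real
  assumes "\<epsilon> > 0"
  shows "\<exists>c > 0. \<forall>n k :: nat. 2 \<le> k \<and> real k \<le> real n powr (1 / 2 - \<epsilon>) \<longrightarrow>
           real (graph_list_dichromatic_number (kneser_graph n k)) \<ge> c * real n * ln (real n)"
proof (cases "\<epsilon> < 1 / 2")
  \<comment> \<open>The exponent is then at most 0, so \<open>k \<le> 1\<close> against
    \<open>2 \<le> k\<close>, and any constant works. For \<open>n = 0\<close> the power is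
    0.\<close>
  case False
  have "\<not> (2 \<le> k \<and> real k \<le> real n powr (1 / 2 - \<epsilon>))" for n k :: nat
  proof (cases "n = 0")
    case False
    then have "real n powr (1 / 2 - \<epsilon>) \<le> real n powr 0"
      using \<open>\<not> \<epsilon> < 1 / 2\<close> by (intro powr_mono) auto
    then show ?thesis using False by auto
  qed simp
  then show ?thesis by (intro exI[of _ 1]) auto
next
  case True
  \<comment> \<open>\<open>t\<close> depends on \<open>\<epsilon>\<close> alone, and hence so do the
    constants below.\<close>
  define t where "t = nat \<lceil>1 / \<epsilon>\<rceil>"
  have "1 / \<epsilon> \<le> real t" unfolding t_def by linarith
  then have t: "1 \<le> \<epsilon> * real t" using assms by (simp add: field_simps)
  define c where "c = \<epsilon> / (32 * (real t + 1))"
  have c: "0 < c" using assms by (simp add: c_def)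
  have "filterlim (\<lambda>n. real n * ln (real n)) at_top sequentially"
    by (intro filterlim_at_top_mult_at_top filterlim_real_sequentially
        filterlim_compose[OF ln_at_top filterlim_real_sequentially])
  then have "eventually (\<lambda>n. 1 / c \<le> real n * ln (real n)) sequentially"
    by (simp add: filterlim_at_top)
  moreover have "eventually (\<lambda>n. 64 * 48 ^ t * real ((2 * t + 4) ^ (2 * t + 1)) * ln (real n) ^ (t + 2)
      < real n powr \<epsilon>) sequentially"
    by (rule eventually_ln_power_less_powr[OF assms])
  ultimately have "eventually (\<lambda>n. 1 / c \<le> real n * ln (real n) \<and>
      64 * 48 ^ t * real ((2 * t + 4) ^ (2 * t + 1)) * ln (real n) ^ (t + 2) < real n powr \<epsilon> \<and>
      max 3 (max (2 ^ t) (36 * (t + 1)\<^sup>2)) \<le> n) sequentially"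
    using eventually_ge_at_top by (intro eventually_conj)
  then obtain n0 where n0: "\<And>n. n0 \<le> n \<Longrightarrow> 1 / c \<le> real n * ln (real n) \<and>
      64 * 48 ^ t * real ((2 * t + 4) ^ (2 * t + 1)) * ln (real n) ^ (t + 2) < real n powr \<epsilon> \<and>
      max 3 (max (2 ^ t) (36 * (t + 1)\<^sup>2)) \<le> n"
    unfolding eventually_sequentially by blast
  \<comment> \<open>For \<open>n < n0\<close> the product \<open>n * ln n\<close> is at most
    \<open>n0\<^sup>2\<close>, so the second entry keeps the claimed bound at most 1, and positivity
    of the list dichromatic number suffices.\<close>
  define c' where "c' = min c (1 / (real n0 ^ 2 + 1))"
  have "c' * real n * ln (real n) \<le> real (graph_list_dichromatic_number (kneser_graph n k))"
    if k: "2 \<le> k" "real k \<le> real n powr (1 / 2 - \<epsilon>)" for n k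
  proof -
    have n: "1 \<le> n" using k by (cases n) auto
    have nonneg: "0 \<le> real n * ln (real n)" using n by simp
    show ?thesis
    proof (cases "n0 \<le> n")
      case True
      have "c' * (real n * ln (real n)) \<le> c * (real n * ln (real n))"
        using nonneg by (intro mult_right_mono) (auto simp: c'_def)
      also have "\<dots> \<le> real (graph_list_dichromatic_number (kneser_graph n k))"
        unfolding c_def
      proof (rule kneser_bound_large[OF assms \<open>\<epsilon> < 1 / 2\<close> t k])
        show "1 \<le> \<epsilon> / (32 * (real t + 1)) * (real n * ln (real n))"
          using n0[OF True] c unfolding c_def[symmetric] by (simp add: field_simps)
      qed (use n0[OF True] in auto)
      finally show ?thesis by (simp add: mult.assoc)
    next
      case False
      have "ln (real n) \<le> real n" using n ln_le_minus_one[of "real n"] by simp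
      then have "real n * ln (real n) \<le> real n0 * real n0"
        using False n by (intro mult_mono) auto
      then have "c' * (real n * ln (real n)) \<le> 1 / (real n0 ^ 2 + 1) * (real n0 ^ 2)"
        using nonneg by (intro mult_mono) (auto simp: c'_def power2_eq_square)
      also have "\<dots> \<le> 1" by (simp add: field_simps add_pos_nonneg)
      also have "\<dots> \<le> real (graph_list_dichromatic_number (kneser_graph n k))"
      proof -
        \<comment> \<open>This gives \<open>k \<le> n\<close>, so there is a vertex; empty lists
          then accept no colouring, and already list size 0 fails.\<close>
        have "real n powr (1 / 2 - \<epsilon>) \<le> real n powr 1" using n assms by (intro powr_mono) auto
        then have "{1..k} \<in> pverts (kneser_graph n k)" using k by (auto simp: kneser_graph_def)
        moreover have G: "pair_graph (kneser_graph n k)" using k by (intro pair_graph_kneser_graph) auto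
        moreover obtain D where D: "orientation (kneser_graph n k) D" using ex_orientation[OF G] by blast
        ultimately have "{1..k} \<in> pverts D" by (simp add: orientation_def)
        then have "\<not> list_dicolourable (with_proj D) 0"
          by (auto simp: list_dicolourable_def list_assignment_def accepts_def intro!: exI[of _ "\<lambda>_. {}"])
        then have "0 < graph_list_dichromatic_number (kneser_graph n k)"
          using less_graph_list_dichromatic_number[OF G D] by blast
        then show ?thesis by simp
      qed
      finally show ?thesis by (simp add: mult.assoc)
    qed
  qed
  moreover have "0 < c'" using c by (simp add: c'_def add_nonneg_pos)
  ultimately show ?thesis by blast
qed

end
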